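(* Let $A\in\mathbb{R}_+^{n\times n}$, $\lambda>0$, let $\mathbf{X}\subseteq\mathbb{R}_+^n$ be an $\underline{x}$-open interval, and let $V(A,\lambda)\cap\mathbf{X}$ be non-empty. (i) $A$ has $\mathbf{X}$-simple image eigencone corresponding to $\lambda$ if and only if $$\operatorname{span}_\oplus(A^{(i)})\cap V(A,\lambda)\cap\mathbf{X}=\emptyset\quad\text{for all } i=1,\dots,n.\qquad( * )$$ (ii) In that case $N_c(A,\lambda)=N$ and $\mathcal{G}_c(A,\lambda)$ consists of disjoint cycles $c_1,\dots,c_k$ for some $k$. (iii) When $N_c(A,\lambda)=N$ and $\mathcal{G}_c(A,\lambda)$ consists of disjoint cycles $c_1,\dots,c_k$, condition $( * )$ is equivalent to $$\operatorname{span}_\oplus(G_{A,\lambda}^{(s)})\cap\mathbf{X}=\emptyset\quad\text{for all } s=1,\dots,k.$$ (iv) In the situation of part (iii) of this theorem, if $\mathbf{X}$ is also $\overline{x}$-closed, then $( * )$ is also equivalent to $$P_{G_{A,\lambda}^{(s)}}\overline{x}\not>\underline{x}\quad\text{for all } s=1,\dots,k.$$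
   Context: Max algebra: $\mathbb{R}_+$ is the set of nonnegative reals with $a\otimes b=ab$, $a\oplus b=\max(a,b)$, extended to matrices and vectors, so $(A\otimes x)_i=\max_j a_{ij}x_j$. $N=\{1,\dots,n\}$. $V(A,\lambda)=\{x\in\mathbb{R}_+^n:A\otimes x=\lambda x\}$; its nonzero elements are the eigenvectors of $A$ associated with $\lambda$. $\operatorname{supp}(x)=\{i:x_i>0\}$. An interval of $\mathbb{R}_+^n$ is a set $\mathbf{X}=\mathbf{X}_1\times\dots\times\mathbf{X}_n$, each $\mathbf{X}_i\subseteq\mathbb{R}_+$ a (nonempty) interval, possibly unbounded. $\underline{x}_i=\inf\mathbf{X}_i$, $\overline{x}_i=\sup\mathbf{X}_i$, $\underline{x}=(\underline{x}_i)$, $\overline{x}=(\overline{x}_i)$. $\mathbf{X}$ is $\underline{x}$-open if $\underline{x}_i\notin\mathbf{X}_i$ for all $i\in N$, and $\overline{x}$-closed if $\overline{x}\in\mathbf{X}$. $A$ has $\mathbf{X}$-simple image eigencone corresponding to $\lambda$ if every eigenvector $x$ of $A$ associated with $\lambda$ and belonging to $\mathbf{X}$ is the unique solution $y$ in $\mathbf{X}$ of $A\otimes y=\lambda x$. For a matrix $B$, $B^{(i)}$ denotes $B$ with its $i$-th column removed; $\operatorname{span}_\oplus(B)=\{\bigoplus_j B_{\cdot j}x_j:x_j\ge0\}$ (equal to $\{0\}$ if $B$ has no columns); $P_B(x)=\max\{y\in\operatorname{span}_\oplus(B):y\le x\}$. For vectors, $u>v$ means $u_i>v_i$ for all $i$,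 and $u\not>v$ is its negation. $\mathcal{G}(A)$ is the digraph on $N$ with an edge $(i,j)$ iff $a_{ij}>0$. Let $x'\in V(A,\lambda)$ have support containing the supports of all $x\in V(A,\lambda)$ and put $N^\lambda=\operatorname{supp}(x')$. The critical graph $\mathcal{G}_c(A,\lambda)$ consists of all nodes and edges belonging to cycles $(i_1,\dots,i_k,i_1)$ of $\mathcal{G}(A)$ with all nodes in $N^\lambda$ and geometric mean $\sqrt[k]{a_{i_1i_2}\cdots a_{i_ki_1}}$ equal to $\lambda$; $N_c(A,\lambda)$ is its node set. Generating matrix: $A_\lambda$ is the $n\times n$ matrix with columns $(A_\lambda)_{\cdot i}=A_{\cdot i}/\lambda$ for $i\in N^\lambda$ and $0$ otherwise; $A_\lambda^+=\bigoplus_{t\ge1}A_\lambda^{\otimes t}$. If $j_1,\dots,j_k$ are the smallest indices in the $k$ strongly connected components of $\mathcal{G}_c(A,\lambda)$, then $G_{A,\lambda}=[(A_\lambda^+)_{\cdot j_1},\dots,(A_\lambda^+)_{\cdot j_k}]\in\mathbb{R}_+^{n\times k}$. $G_{A,\lambda}^{(s)}$ is $G_{A,\lambda}$ with its $s$-th column (the one indexed by $j_s$) removed. *)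

theory Defs
  imports
    "HOL-Analysis.Topology_Euclidean_Space"
    "Jordan_Normal_Form.Matrix"
    "Graph_Theory.Graph_Theory"
begin

text \<open>
  Matrices and vectors are those of \<open>Jordan_Normal_Form.Matrix\<close>, because the number of columns
  of the generating matrix depends on the input matrix.  Indices start at 0, so \<open>{..<n}\<close>
  is the index set of the literature's \<open>{1, ..., n}\<close>.
\<close>

section \<open>Max algebra over the nonnegative reals\<close>

definition nonneg_vecs :: "nat \<Rightarrow> real vec set" where
  "nonneg_vecs n = {x \<in> carrier_vec n. \<forall>i<n. 0 \<le> x $ i}"

definition nonneg_mats :: "nat \<Rightarrow> nat \<Rightarrow> real mat set" where
  "nonneg_mats n m = {A \<in> carrier_mat n m. \<forall>i<n. \<forall>j<m. 0 \<le> A $$ (i, j)}"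

text \<open>
  The finite \<open>\<oplus>\<close>-sum of \<open>f 0, ..., f (m - 1)\<close>.  As 0 is the neutral element of \<open>\<oplus>\<close> on the
  nonnegative reals, inserting it only matters for the empty sum.
\<close>

definition max_sum :: "nat \<Rightarrow> (nat \<Rightarrow> real) \<Rightarrow> real" where
  "max_sum m f = Max (insert 0 (f ` {..<m}))"

definition max_mult_vec :: "real mat \<Rightarrow> real vec \<Rightarrow> real vec" where
  "max_mult_vec A x = vec (dim_row A) (\<lambda>i. max_sum (dim_col A) (\<lambda>j. A $$ (i, j) * x $ j))"

definition max_mult_mat :: "real mat \<Rightarrow> real mat \<Rightarrow> real mat" where
  "max_mult_mat A B = mat (dim_row A) (dim_col B)
     (\<lambda>(i, j). max_sum (dim_col A) (\<lambda>k. A $$ (i, k) * B $$ (k, j)))"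

primrec max_pow :: "real mat \<Rightarrow> nat \<Rightarrow> real mat" where
  "max_pow A 0 = 1\<^sub>m (dim_row A)"
| "max_pow A (Suc t) = max_mult_mat A (max_pow A t)"

definition supp :: "real vec \<Rightarrow> nat set" where
  "supp x = {i. i < dim_vec x \<and> 0 < x $ i}"

definition eigencone :: "real mat \<Rightarrow> real \<Rightarrow> real vec set" where
  "eigencone A l = {x \<in> nonneg_vecs (dim_col A). max_mult_vec A x = l \<cdot>\<^sub>v x}"

definition max_span :: "real mat \<Rightarrow> real vec set" where
  "max_span B = max_mult_vec B ` nonneg_vecs (dim_col B)"

definition remove_col :: "real mat \<Rightarrow> nat \<Rightarrow> real mat" where
  "remove_col B s = mat (dim_row B) (dim_col B - 1)
     (\<lambda>(i, j). B $$ (i, if j < s then j else Suc j))"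

text \<open>The order on vectors is the library's componentwise one.\<close>

definition max_proj :: "real mat \<Rightarrow> real vec \<Rightarrow> real vec" where
  "max_proj B x = (GREATEST y. y \<in> max_span B \<and> y \<le> x)"

text \<open>Strict inequality in every component; this is not the library's \<open><\<close> on vectors.\<close>

definition vec_greater :: "real vec \<Rightarrow> real vec \<Rightarrow> bool" where
  "vec_greater u v \<longleftrightarrow> dim_vec u = dim_vec v \<and> (\<forall>i<dim_vec v. v $ i < u $ i)"


section \<open>Intervals\<close>

definition nonneg_interval :: "real set \<Rightarrow> bool" where
  "nonneg_interval S \<longleftrightarrow> S \<noteq> {} \<and> S \<subseteq> {0..} \<and> is_interval S"

definition interval_box :: "nat \<Rightarrow> (nat \<Rightarrow> real set) \<Rightarrow> real vec set" where
  "interval_box n I = {x \<in> carrier_vec n. \<forall>i<n. x $ i \<in> I i}"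

definition lower_vec :: "nat \<Rightarrow> (nat \<Rightarrow> real set) \<Rightarrow> real vec" where
  "lower_vec n I = vec n (\<lambda>i. Inf (I i))"

text \<open>
  A component of \<open>upper_vec\<close> is meaningful only if the corresponding interval is bounded above.
  \<open>upper_closed\<close> includes this: an infinite supremum is not an element of the interval.
\<close>

definition upper_vec :: "nat \<Rightarrow> (nat \<Rightarrow> real set) \<Rightarrow> real vec" where
  "upper_vec n I = vec n (\<lambda>i. Sup (I i))"

definition lower_open :: "nat \<Rightarrow> (nat \<Rightarrow> real set) \<Rightarrow> bool" where
  "lower_open n I \<longleftrightarrow> (\<forall>i<n. lower_vec n I $ i \<notin> I i)"

definition upper_closed :: "nat \<Rightarrow> (nat \<Rightarrow> real set) \<Rightarrow> bool" where
  "upper_closed n I \<longleftrightarrow> (\<forall>i<n. bdd_above (I i)) \<and> upper_vec n I \<in> interval_box n I"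

definition simple_image_eigencone :: "real mat \<Rightarrow> real \<Rightarrow> real vec set \<Rightarrow> bool" where
  "simple_image_eigencone A l X \<longleftrightarrow>
     (\<forall>x \<in> eigencone A l \<inter> X. x \<noteq> 0\<^sub>v (dim_col A) \<longrightarrow>
        {y \<in> X. max_mult_vec A y = l \<cdot>\<^sub>v x} = {x})"


section \<open>Critical graph and generating matrix\<close>

definition mat_digraph :: "real mat \<Rightarrow> nat pair_pre_digraph" where
  "mat_digraph A = \<lparr> pverts = {..<dim_row A},
     parcs = {(i, j). i < dim_row A \<and> j < dim_col A \<and> 0 < A $$ (i, j)} \<rparr>"

text \<open>
  The largest support of a vector of the eigencone (written \<open>N\<close> with superscript \<open>\<lambda>\<close>); it exists
  because the eigencone is closed under componentwise maxima.
\<close>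

definition eigen_supp :: "real mat \<Rightarrow> real \<Rightarrow> nat set" where
  "eigen_supp A l =
     supp (SOME x'. x' \<in> eigencone A l \<and> (\<forall>x \<in> eigencone A l. supp x \<subseteq> supp x'))"

text \<open>
  A cycle is given by its list of edges; its nodes are the first components of the edges.
  Cycles are elementary (no repeated node) and loops are cycles of length 1.
\<close>

definition cycle_nodes :: "(nat \<times> nat) list \<Rightarrow> nat set" where
  "cycle_nodes c = fst ` set c"

definition cycle_geo_mean :: "real mat \<Rightarrow> (nat \<times> nat) list \<Rightarrow> real" where
  "cycle_geo_mean A c = root (length c) (\<Prod>e\<leftarrow>c. A $$ e)"

definition critical_cycles :: "real mat \<Rightarrow> real \<Rightarrow> (nat \<times> nat) list set" where
  "critical_cycles A l = {c. pre_digraph.cycle (with_proj (mat_digraph A)) c \<and>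
     cycle_nodes c \<subseteq> eigen_supp A l \<and> cycle_geo_mean A c = l}"

definition critical_graph :: "real mat \<Rightarrow> real \<Rightarrow> nat pair_pre_digraph" where
  "critical_graph A l = \<lparr> pverts = (\<Union>c \<in> critical_cycles A l. cycle_nodes c),
     parcs = (\<Union>c \<in> critical_cycles A l. set c) \<rparr>"

definition critical_nodes :: "real mat \<Rightarrow> real \<Rightarrow> nat set" where
  "critical_nodes A l = pverts (critical_graph A l)"

text \<open>\<open>G\<close> consists of the pairwise node-disjoint cycles \<open>cs ! 0, ..., cs ! (length cs - 1)\<close>.\<close>

definition consists_of_disjoint_cycles ::
    "nat pair_pre_digraph \<Rightarrow> (nat \<times> nat) list list \<Rightarrow> bool" where
  "consists_of_disjoint_cycles G cs \<longleftrightarrow>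
     (\<forall>c \<in> set cs. pre_digraph.cycle (with_proj G) c) \<and>
     (\<forall>s<length cs. \<forall>t<length cs. s \<noteq> t \<longrightarrow> cycle_nodes (cs ! s) \<inter> cycle_nodes (cs ! t) = {}) \<and>
     pverts G = (\<Union>c \<in> set cs. cycle_nodes c) \<and>
     parcs G = (\<Union>c \<in> set cs. set c)"

definition scaled_mat :: "real mat \<Rightarrow> real \<Rightarrow> real mat" where
  "scaled_mat A l = mat (dim_row A) (dim_col A)
     (\<lambda>(i, j). if j \<in> eigen_supp A l then A $$ (i, j) / l else 0)"

text \<open>
  The series of max-powers, as an entrywise supremum.  It is applied to \<open>scaled_mat A l\<close> only,
  where the suprema are finite for \<open>l > 0\<close>: every cycle there has geometric mean at most 1.
\<close>

definition max_plus_closure :: "real mat \<Rightarrow> real mat" where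
  "max_plus_closure B = mat (dim_row B) (dim_col B) (\<lambda>(i, j). SUP t\<in>{1..}. max_pow B t $$ (i, j))"

definition component_reps :: "real mat \<Rightarrow> real \<Rightarrow> nat list" where
  "component_reps A l =
     sorted_list_of_set (Min ` pre_digraph.sccs_verts (with_proj (critical_graph A l)))"

definition generating_mat :: "real mat \<Rightarrow> real \<Rightarrow> real mat" where
  "generating_mat A l = mat_of_cols (dim_row A)
     (map (col (max_plus_closure (scaled_mat A l))) (component_reps A l))"

end

(*
  Fix a positive eigenvector x and call (i, j) active if a_ij x_j = l x_i.  The system
  A (x) y = l x has y = x as its only solution iff every column i has a private row, in which
  (k, i) is the only active pair; this is also equivalent to x not lying in the span of any A with
  one column removed.  Lower-openness of X makes uniqueness in X as strong as global uniqueness, as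
  a component that is never needed can be lowered a little inside X.  Private rows for all n columns
  make the active graph a permutation, i.e. disjoint cycles, and an active arc on an active cycle
  is critical.

  Conversely, if the critical graph is a permutation, private rows fail exactly if some active arc
  leads from one critical component to another.  Then x is generated without the column of the
  first component, since active walks attain A_l^+(i, j) x_j = x_i.  Without such an arc, walks
  leaving a component lose a fixed factor q < 1, so no other column can generate the entry of x
  there.
*)

theory Submission
  imports Defs
begin

unbundle no vec_syntax

section \<open>Finite maxima, spans and projections\<close>

text \<open>Two facts lie behind every step. First, \<open>lower_open\<close> forces each entry of a
  vector in the box above an infimum that is at least 0, so an eigenvector in the box has no zero
  entry. Conjugating \<open>A\<close> divided by \<open>l\<close> with the diagonal matrix of such
  an \<open>x\<close> keeps all cycle products and yields entries at most 1, with a 1 in every row.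
  Hence critical cycles are active at every positive eigenvector, although the active graph varies
  with the eigenvector and the critical graph does not. Second, the span condition on
  \<open>A\<close> speaks about all eigenvectors in the box, but it splits into one statement per
  eigenvector, so the equivalences are proved at a single \<open>x\<close> and quantified only at
  the end. The eigencone disappears from the condition in (iii) because max combinations of columns
  of \<open>generating_mat\<close> are eigenvectors again. The projection in (iv) enters because a
  span meets a box with a greatest point exactly if the greatest element of the span below that
  point lies in the box.\<close>

lemma max_sum_le_iff: "max_sum m f \<le> c \<longleftrightarrow> 0 \<le> c \<and> (\<forall>j<m. f j \<le> c)"
  unfolding max_sum_def by (subst Max_le_iff) auto

lemma max_sum_upper: "j < m \<Longrightarrow> f j \<le> max_sum m f"
  using max_sum_le_iff by blast

lemma max_sum_nonneg: "0 \<le> max_sum m f"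
  using max_sum_le_iff by blast

text \<open>Positivity of \<open>c\<close> excludes the inserted default 0, so the maximum comes
  from a genuine index. Zero maxima need separate treatment wherever this is used.\<close>

lemma max_sum_attained:
  assumes "max_sum m f = c" "0 < c"
  shows "\<exists>j<m. f j = c"
proof -
  have "max_sum m f \<in> insert 0 (f ` {..<m})"
    unfolding max_sum_def by (rule Max_in) auto
  with assms show ?thesis by auto
qed

lemma max_sum_eqI:
  assumes "\<And>j. j < m \<Longrightarrow> f j \<le> c" "j < m" "f j = c" "0 \<le> c"
  shows "max_sum m f = c"
proof (rule antisym)
  show "max_sum m f \<le> c" using assms by (simp add: max_sum_le_iff)
  show "c \<le> max_sum m f" using max_sum_upper[OF assms(2), of f] assms(3) by simp
qed

lemma max_sum_cong: "(\<And>j. j < m \<Longrightarrow> f j = g j) \<Longrightarrow> max_sum m f = max_sum m g"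
  unfolding max_sum_def by (rule arg_cong[where f = Max]) auto

text \<open>A zero term never exceeds the default 0, so it can be skipped. The index shift is the
  one in \<open>remove_col\<close>.\<close>

lemma max_sum_skip_zero:
  assumes "s < m" "f s = 0"
  shows "max_sum (m - 1) (\<lambda>j. f (if j < s then j else Suc j)) = max_sum m f"
proof (rule antisym)
  show "max_sum (m - 1) (\<lambda>j. f (if j < s then j else Suc j)) \<le> max_sum m f"
    using assms(1) by (auto simp: max_sum_le_iff max_sum_nonneg intro!: max_sum_upper)
  show "max_sum m f \<le> max_sum (m - 1) (\<lambda>j. f (if j < s then j else Suc j))" (is "_ \<le> ?r")
    unfolding max_sum_le_iff
  proof (intro conjI allI impI)
    fix j assume j: "j < m"
    have up: "f (if i < s then i else Suc i) \<le> ?r" if "i < m - 1" for i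
      by (rule max_sum_upper[OF that])
    consider "j < s" | "j = s" | "s < j" by linarith
    then show "f j \<le> ?r"
    proof cases
      case 1 then show ?thesis using up[of j] assms(1) by simp
    next
      case 2 then show ?thesis using assms(2) by (simp add: max_sum_nonneg)
    next
      case 3
      then obtain i where "j = Suc i" "s \<le> i" by (cases j) auto
      then show ?thesis using up[of i] j by simp
    qed
  qed (rule max_sum_nonneg)
qed

lemma dim_max_mult_vec [simp]: "dim_vec (max_mult_vec B z) = dim_row B"
  by (simp add: max_mult_vec_def)

lemma index_max_mult_vec [simp]:
  "i < dim_row B \<Longrightarrow> max_mult_vec B z $ i = max_sum (dim_col B) (\<lambda>j. B $$ (i, j) * z $ j)"
  by (simp add: max_mult_vec_def)

lemma dim_remove_col [simp]:
  "dim_row (remove_col B s) = dim_row B" "dim_col (remove_col B s) = dim_col B - 1"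
  by (simp_all add: remove_col_def)

text \<open>Trades a missing column for a vanishing coefficient, so that no later argument has to
  handle shifted column indices.\<close>

lemma mem_max_span_remove_col_iff:
  assumes s: "s < dim_col B"
  shows "y \<in> max_span (remove_col B s) \<longleftrightarrow>
    (\<exists>z \<in> nonneg_vecs (dim_col B). z $ s = 0 \<and> y = max_mult_vec B z)"
proof
  let ?m = "dim_col B"
  assume "y \<in> max_span (remove_col B s)"
  then obtain w where w: "w \<in> nonneg_vecs (?m - 1)" and y: "y = max_mult_vec (remove_col B s) w"
    by (auto simp: max_span_def)
  define z where "z = vec ?m (\<lambda>j. if j < s then w $ j else if j = s then 0 else w $ (j - 1))"
  have "max_mult_vec B z = y"
  proof (rule eq_vecI)
    fix i assume i: "i < dim_vec y"
    with y have i': "i < dim_row B" by simp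
    have "max_sum ?m (\<lambda>j. B $$ (i, j) * z $ j)
        = max_sum (?m - 1) (\<lambda>j. B $$ (i, if j < s then j else Suc j) * z $ (if j < s then j else Suc j))"
      using max_sum_skip_zero[of s ?m "\<lambda>j. B $$ (i, j) * z $ j"] s by (simp add: z_def)
    also have "\<dots> = max_sum (?m - 1) (\<lambda>j. remove_col B s $$ (i, j) * w $ j)"
      by (rule max_sum_cong) (use i' s in \<open>auto simp: z_def remove_col_def\<close>)
    finally show "max_mult_vec B z $ i = y $ i" using i' y by simp
  qed (simp add: y)
  moreover have "z \<in> nonneg_vecs ?m" "z $ s = 0"
    using w s by (auto simp: z_def nonneg_vecs_def)
  ultimately show "\<exists>z \<in> nonneg_vecs ?m. z $ s = 0 \<and> y = max_mult_vec B z" by blast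
next
  let ?m = "dim_col B"
  assume "\<exists>z \<in> nonneg_vecs ?m. z $ s = 0 \<and> y = max_mult_vec B z"
  then obtain z where z: "z \<in> nonneg_vecs ?m" "z $ s = 0" and y: "y = max_mult_vec B z" by blast
  define w where "w = vec (?m - 1) (\<lambda>j. z $ (if j < s then j else Suc j))"
  have "max_mult_vec (remove_col B s) w = y"
  proof (rule eq_vecI)
    fix i assume i: "i < dim_vec y"
    with y have i': "i < dim_row B" by simp
    have "max_sum (?m - 1) (\<lambda>j. remove_col B s $$ (i, j) * w $ j)
        = max_sum (?m - 1) (\<lambda>j. B $$ (i, if j < s then j else Suc j) * z $ (if j < s then j else Suc j))"
      by (rule max_sum_cong) (use i' s in \<open>auto simp: w_def remove_col_def\<close>)
    also have "\<dots> = max_sum ?m (\<lambda>j. B $$ (i, j) * z $ j)"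
      using max_sum_skip_zero[of s ?m "\<lambda>j. B $$ (i, j) * z $ j"] s z(2) by simp
    finally show "max_mult_vec (remove_col B s) w $ i = y $ i" using i' y by simp
  qed (simp add: y)
  moreover have "w \<in> nonneg_vecs (?m - 1)"
    using z(1) s by (auto simp: w_def nonneg_vecs_def)
  ultimately show "y \<in> max_span (remove_col B s)" unfolding max_span_def by force
qed

text \<open>Residuation: the largest admissible coefficient of column \<open>j\<close> is the
  minimum of the quotients \<open>u $ i / B $$ (i, j)\<close> over the support of the column, and
  these coefficients together give the greatest element. Its existence is what makes the
  \<open>GREATEST\<close> in \<open>max_proj\<close> meaningful.\<close>

lemma max_proj_greatest:
  assumes B: "B \<in> nonneg_mats n m" and u: "u \<in> nonneg_vecs n"
  shows "max_proj B u \<in> max_span B" "max_proj B u \<le> u"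
    and "\<And>y. y \<in> max_span B \<Longrightarrow> y \<le> u \<Longrightarrow> y \<le> max_proj B u"
proof -
  have dims [simp]: "dim_row B = n" "dim_col B = m" "dim_vec u = n"
    and B0: "\<And>i j. i < n \<Longrightarrow> j < m \<Longrightarrow> 0 \<le> B $$ (i, j)" and u0: "\<And>i. i < n \<Longrightarrow> 0 \<le> u $ i"
    using B u by (auto simp: nonneg_mats_def nonneg_vecs_def)
  define R where "R j = {i. i < n \<and> 0 < B $$ (i, j)}" for j
  \<comment> \<open>A zero column contributes nothing whatever its coefficient; 0 is chosen there
    because the minimum over an empty set is unspecified.\<close>
  define z where "z = vec m (\<lambda>j. if R j = {} then 0 else Min ((\<lambda>i. u $ i / B $$ (i, j)) ` R j))"
  have fin: "finite (R j)" for j by (simp add: R_def)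
  have z_nonneg: "0 \<le> z $ j" if "j < m" for j
    using that fin[of j] u0 by (auto simp: z_def R_def)
  define p where "p = max_mult_vec B z"
  have span: "p \<in> max_span B"
    using z_nonneg unfolding p_def max_span_def by (auto simp: nonneg_vecs_def z_def)
  have le: "p \<le> u"
    unfolding less_eq_vec_def
  proof (intro conjI allI impI)
    fix i assume "i < dim_vec u"
    then have i: "i < n" by simp
    have "B $$ (i, j) * z $ j \<le> u $ i" if j: "j < m" for j
    proof (cases "0 < B $$ (i, j)")
      case True
      then have iR: "i \<in> R j" using i by (simp add: R_def)
      then have "z $ j \<le> u $ i / B $$ (i, j)"
        using j fin[of j] by (auto simp: z_def)
      then show ?thesis using True by (simp add: field_simps)
    next
      case False
      then show ?thesis using B0[OF i j] u0[OF i] by simp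
    qed
    then show "p $ i \<le> u $ i" using i u0 by (simp add: p_def max_sum_le_iff)
  qed (simp add: p_def)
  have greatest: "y \<le> p" if y: "y \<in> max_span B" "y \<le> u" for y
  proof -
    from y(1) obtain w where w: "w \<in> nonneg_vecs m" and yw: "y = max_mult_vec B w"
      by (auto simp: max_span_def)
    have "B $$ (i, j) * w $ j \<le> B $$ (i, j) * z $ j" if i: "i < n" and j: "j < m" for i j
    proof (cases "0 < B $$ (i, j)")
      case True
      then have ne: "R j \<noteq> {}" using i by (auto simp: R_def)
      have "w $ j \<le> u $ k / B $$ (k, j)" if k: "k \<in> R j" for k
      proof -
        from k have k': "k < n" "0 < B $$ (k, j)" by (auto simp: R_def)
        have "B $$ (k, j) * w $ j \<le> y $ k"
          using k' max_sum_upper[OF j, of "\<lambda>j. B $$ (k, j) * w $ j"] by (simp add: yw)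
        also have "\<dots> \<le> u $ k" using y(2) k' by (simp add: less_eq_vec_def)
        finally show ?thesis using k' by (simp add: field_simps)
      qed
      then have "w $ j \<le> z $ j" using ne j fin[of j] by (simp add: z_def)
      then show ?thesis using True by simp
    next
      case False
      then show ?thesis using B0[OF i j] by simp
    qed
    then have "max_sum m (\<lambda>j. B $$ (i, j) * w $ j) \<le> max_sum m (\<lambda>j. B $$ (i, j) * z $ j)"
      if "i < n" for i
      using that max_sum_upper[of _ m "\<lambda>j. B $$ (i, j) * z $ j"]
      by (auto simp: max_sum_le_iff max_sum_nonneg intro: order_trans)
    then show "y \<le> p" by (simp add: less_eq_vec_def yw p_def)
  qed
  have "max_proj B u = p"
    unfolding max_proj_def by (rule Greatest_equality) (use span le greatest in auto)
  with span le greatest show "max_proj B u \<in> max_span B" "max_proj B u \<le> u"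
    "\<And>y. y \<in> max_span B \<Longrightarrow> y \<le> u \<Longrightarrow> y \<le> max_proj B u" by auto
qed

section \<open>Cycles and strongly connected components\<close>

text \<open>Reduces the library's cycles to functions that recurse directly on lists of
  pairs.\<close>

lemma cycle_with_proj_iff:
  "pre_digraph.cycle (with_proj G) c \<longleftrightarrow>
    (\<exists>u \<in> pverts G. set c \<subseteq> parcs G \<and> pcas u c u \<and> distinct (tl (pawalk_verts u c)) \<and> c \<noteq> [])"
  by (auto simp: pre_digraph.cycle_def pre_digraph.awalk_def cas_with_proj_eq
      awalk_verts_with_proj_eq)

lemma pawalk_verts_conv:
  "pcas u c v \<Longrightarrow> pawalk_verts u c = map fst c @ [v]"
  by (induction c arbitrary: u) auto

text \<open>The heads of a walk are its tails shifted by one place, so the two products differ only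
  in the endpoint factors. With \<open>f\<close> the entries of an eigenvector, this makes the
  entries cancel around a cycle.\<close>

lemma pcas_prod_list:
  fixes f :: "'a \<Rightarrow> 'b::comm_monoid_mult"
  assumes "pcas u c v"
  shows "f u * (\<Prod>e\<leftarrow>c. f (snd e)) = (\<Prod>e\<leftarrow>c. f (fst e)) * f v"
  using assms
proof (induction c arbitrary: u)
  case (Cons e c)
  then have "f u * (\<Prod>e\<leftarrow>e # c. f (snd e)) = f u * (f (snd e) * (\<Prod>e\<leftarrow>c. f (snd e)))" by simp
  also have "\<dots> = f u * ((\<Prod>e\<leftarrow>c. f (fst e)) * f v)" using Cons by simp
  finally show ?case using Cons.prems by (simp add: mult_ac)
qed simp

lemma pcas_rtrancl:
  assumes "pcas u c v" "e \<in> set c"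
  shows "(u, fst e) \<in> (set c)\<^sup>*" "(snd e, v) \<in> (set c)\<^sup>*"
proof -
  from assms(2) obtain a b where c: "c = a @ e # b" by (auto simp: in_set_conv_decomp)
  have split: "pcas u (a @ b) v \<longleftrightarrow> (\<exists>w. pcas u a w \<and> pcas w b v)"
    for u v :: 'a and a b :: "('a \<times> 'a) list"
    by (induction a arbitrary: u) auto
  have walk: "(u, v) \<in> (set a)\<^sup>*" if "pcas u a v" for u v :: 'a and a
    using that
  proof (induction a arbitrary: u)
    case (Cons e a)
    then have "(snd e, v) \<in> (set (e # a))\<^sup>*"
      by (meson pcas.simps(2) rtrancl_mono set_subset_Cons subsetD)
    moreover have "(u, snd e) \<in> set (e # a)" using Cons.prems by (cases e) auto
    ultimately show ?case by (rule converse_rtrancl_into_rtrancl[rotated])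
  qed simp
  from assms(1) c split have "pcas u a (fst e)" "pcas (snd e) b v" by auto
  then have "(u, fst e) \<in> (set a)\<^sup>*" "(snd e, v) \<in> (set b)\<^sup>*" using walk by blast+
  moreover have "set a \<subseteq> set c" "set b \<subseteq> set c" using c by auto
  ultimately show "(u, fst e) \<in> (set c)\<^sup>*" "(snd e, v) \<in> (set c)\<^sup>*"
    by (meson rtrancl_mono subsetD)+
qed

lemma
  fixes c :: "('a \<times> 'a) list"
  assumes "pre_digraph.cycle (with_proj G) c"
  shows cycle_not_Nil: "c \<noteq> []"
    and cycle_arcs: "set c \<subseteq> parcs G"
    and cycle_distinct: "distinct (map fst c)"
    and cycle_heads: "snd ` set c = fst ` set c"
    and cycle_connected: "\<And>u v. u \<in> fst ` set c \<Longrightarrow> v \<in> fst ` set c \<Longrightarrow> (u, v) \<in> (set c)\<^sup>*"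
    and cycle_prod_list: "\<And>f :: 'a \<Rightarrow> 'b::field.
      (\<And>e. e \<in> set c \<Longrightarrow> f (fst e) \<noteq> 0) \<Longrightarrow> (\<Prod>e\<leftarrow>c. f (snd e)) = (\<Prod>e\<leftarrow>c. f (fst e))"
proof -
  from assms obtain u where u: "set c \<subseteq> parcs G" "pcas u c u"
    "distinct (tl (pawalk_verts u c))" "c \<noteq> []"
    by (auto simp: cycle_with_proj_iff)
  then show "c \<noteq> []" "set c \<subseteq> parcs G" by auto
  from u obtain e c' where c: "c = e # c'" "fst e = u" by (cases c) auto
  \<comment> \<open>The vertex list of the closed walk ends with \<open>u\<close> again, so its tail
    is a rotation of the list of arc tails.\<close>
  with u show "distinct (map fst c)" by (auto simp: pawalk_verts_conv)
  have heads: "map snd c = tl (map fst c @ [u])"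
  proof -
    have "map snd c = tl (map fst c @ [v])" if "pcas w c v" for w v
      using that
    proof (induction c arbitrary: w)
      case (Cons e c)
      then show ?case by (cases c) auto
    qed simp
    then show ?thesis using u(2) by blast
  qed
  have "snd ` set c = set (map snd c)" by simp
  also have "\<dots> = fst ` set c" unfolding heads using c by auto
  finally show "snd ` set c = fst ` set c" .
  \<comment> \<open>Every node of the cycle reaches the base point \<open>u\<close> and is reached
    from it, so going through \<open>u\<close> connects any two nodes.\<close>
  have to_u: "(v, u) \<in> (set c)\<^sup>*" if "v \<in> fst ` set c" for v
    using that pcas_rtrancl(2)[OF u(2)] by (force intro: converse_rtrancl_into_rtrancl)
  show "(v, w) \<in> (set c)\<^sup>*" if "v \<in> fst ` set c" "w \<in> fst ` set c" for v w
    using to_u[OF that(1)] that(2) pcas_rtrancl(1)[OF u(2)] by (auto intro: rtrancl_trans)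
  fix f :: "'a \<Rightarrow> 'b"
  assume nz: "\<And>e. e \<in> set c \<Longrightarrow> f (fst e) \<noteq> 0"
  have "f u \<noteq> 0" using nz[of e] c by simp
  then show "(\<Prod>e\<leftarrow>c. f (snd e)) = (\<Prod>e\<leftarrow>c. f (fst e))"
    using pcas_prod_list[OF u(2), of f] by (simp add: mult.commute)
qed

text \<open>Disjointness puts two arcs with a common tail on the same cycle, and an elementary cycle
  has only one arc per tail.\<close>

lemma single_valued_disjoint_cycles:
  assumes "consists_of_disjoint_cycles G cs"
  shows "single_valued (parcs G)"
proof (rule single_valuedI)
  fix u v w assume "(u, v) \<in> parcs G" "(u, w) \<in> parcs G"
  then obtain s t where s: "s < length cs" "(u, v) \<in> set (cs ! s)"
    and t: "t < length cs" "(u, w) \<in> set (cs ! t)"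
    using assms unfolding consists_of_disjoint_cycles_def by (metis UN_E in_set_conv_nth)
  have "u \<in> cycle_nodes (cs ! s) \<inter> cycle_nodes (cs ! t)"
    using s t by (force simp: cycle_nodes_def)
  then have "s = t"
    using s t assms unfolding consists_of_disjoint_cycles_def by blast
  moreover have "distinct (map fst (cs ! s))"
    using s assms cycle_distinct unfolding consists_of_disjoint_cycles_def by (metis nth_mem)
  ultimately show "v = w"
    using s t by (metis eq_key_imp_eq_value)
qed

text \<open>The only arc of \<open>G\<close> leaving a node of the cycle is the arc of the cycle
  itself.\<close>

lemma single_valued_cycle_closed:
  assumes "single_valued (parcs G)" "pre_digraph.cycle (with_proj G) c"
    and "(u, v) \<in> (parcs G)\<^sup>*" "u \<in> cycle_nodes c"
  shows "v \<in> cycle_nodes c"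
  using assms(3,4)
proof (induction rule: rtrancl_induct)
  case (step v w)
  then obtain w' where "(v, w') \<in> set c" by (auto simp: cycle_nodes_def)
  moreover from this have "w' = w"
    using assms(1) step.hyps(2) cycle_arcs[OF assms(2)] by (meson single_valuedD subsetD)
  ultimately show ?case
    using cycle_heads[OF assms(2)] unfolding cycle_nodes_def by (metis imageI snd_conv)
qed

text \<open>Each cycle is strongly connected and, by single-valuedness, cannot be left. This
  identifies the given cycles with the components that index the columns of the generating
  matrix.\<close>

lemma disjoint_cycles_sccs_verts:
  assumes G: "pair_wf_digraph G" and cs: "consists_of_disjoint_cycles G cs"
  shows "pre_digraph.sccs_verts (with_proj G) = cycle_nodes ` set cs"
    and "inj_on cycle_nodes (set cs)" "distinct cs"
proof -
  interpret pair_wf_digraph G by (rule G)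
  have cyc: "pre_digraph.cycle (with_proj G) c" if "c \<in> set cs" for c
    using that cs by (simp add: consists_of_disjoint_cycles_def)
  have nonempty: "cycle_nodes c \<noteq> {}" if "c \<in> set cs" for c
    using cycle_not_Nil[OF cyc[OF that]] by (simp add: cycle_nodes_def)
  have disj: "s = t" if "s < length cs" "t < length cs"
    "cycle_nodes (cs ! s) \<inter> cycle_nodes (cs ! t) \<noteq> {}" for s t
    using that cs unfolding consists_of_disjoint_cycles_def by blast
  show "inj_on cycle_nodes (set cs)"
    by (rule inj_onI) (metis disj nonempty in_set_conv_nth inf.idem)
  show "distinct cs"
    unfolding distinct_conv_nth by (metis disj nonempty inf.idem nth_mem)
  have reach: "u \<rightarrow>\<^sup>*\<^bsub>with_proj G\<^esub> v \<longleftrightarrow> (u, v) \<in> (parcs G)\<^sup>* \<and> u \<in> pverts G" for u v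
    using reachable_conv[of u v] in_arcsD2
    by (auto elim: rtranclE)
  have verts: "pverts G = (\<Union>c \<in> set cs. cycle_nodes c)"
    using cs by (simp add: consists_of_disjoint_cycles_def)
  have conn: "u \<rightarrow>\<^sup>*\<^bsub>with_proj G\<^esub> v" if "c \<in> set cs" "u \<in> cycle_nodes c" "v \<in> cycle_nodes c" for c u v
    using cycle_connected[OF cyc[OF that(1)], of u v] rtrancl_mono[OF cycle_arcs[OF cyc[OF that(1)]]]
      that verts unfolding reach cycle_nodes_def by blast
  have closed: "v \<in> cycle_nodes c" if "c \<in> set cs" "u \<in> cycle_nodes c" "u \<rightarrow>\<^sup>*\<^bsub>with_proj G\<^esub> v" for c u v
    using single_valued_cycle_closed[OF single_valued_disjoint_cycles[OF cs] cyc[OF that(1)]] that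
    unfolding reach by blast
  show "pre_digraph.sccs_verts (with_proj G) = cycle_nodes ` set cs"
  proof (intro equalityI subsetI)
    fix S assume "S \<in> pre_digraph.sccs_verts (with_proj G)"
    then have S: "S \<noteq> {}" "\<And>u v. u \<in> S \<Longrightarrow> v \<in> S \<Longrightarrow> u \<rightarrow>\<^sup>*\<^bsub>with_proj G\<^esub> v"
      "\<And>u v. u \<in> S \<Longrightarrow> v \<notin> S \<Longrightarrow> \<not> u \<rightarrow>\<^sup>*\<^bsub>with_proj G\<^esub> v \<or> \<not> v \<rightarrow>\<^sup>*\<^bsub>with_proj G\<^esub> u"
      unfolding pre_digraph.sccs_verts_def by auto
    then obtain u where u: "u \<in> S" by blast
    with S(2)[OF u u] obtain c where c: "c \<in> set cs" "u \<in> cycle_nodes c"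
      unfolding reach verts by blast
    have "S = cycle_nodes c"
      using S u c conn closed by blast
    with c show "S \<in> cycle_nodes ` set cs" by blast
  next
    fix S assume "S \<in> cycle_nodes ` set cs"
    then obtain c where c: "c \<in> set cs" "S = cycle_nodes c" by blast
    then show "S \<in> pre_digraph.sccs_verts (with_proj G)"
      unfolding pre_digraph.sccs_verts_def using nonempty conn closed by blast
  qed
qed

text \<open>\<open>component_reps\<close> is built from a set of minima, in which equal minima would
  collapse. The cycles are nonempty and disjoint, so their minima differ.\<close>

lemma length_component_reps:
  assumes "pair_wf_digraph (critical_graph A l)"
    and cs: "consists_of_disjoint_cycles (critical_graph A l) cs"
  shows "length (component_reps A l) = length cs"
proof -
  note sccs = disjoint_cycles_sccs_verts[OF assms]
  have "inj_on Min (cycle_nodes ` set cs)"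
  proof (rule inj_onI, clarify)
    fix c d assume *: "c \<in> set cs" "d \<in> set cs" "Min (cycle_nodes c) = Min (cycle_nodes d)"
    have "Min (cycle_nodes c) \<in> cycle_nodes c" if "c \<in> set cs" for c
    proof (rule Min_in)
      show "cycle_nodes c \<noteq> {}"
        using that cs cycle_not_Nil
        unfolding consists_of_disjoint_cycles_def cycle_nodes_def by fastforce
    qed (simp add: cycle_nodes_def)
    with * have "cycle_nodes c \<inter> cycle_nodes d \<noteq> {}" by (metis IntI empty_iff)
    with * cs show "cycle_nodes c = cycle_nodes d"
      unfolding consists_of_disjoint_cycles_def by (metis in_set_conv_nth)
  qed
  then show ?thesis
    using sccs by (simp add: component_reps_def card_image distinct_card)
qed

section \<open>Active arcs at a positive eigenvector\<close>

text \<open>The vector is a parameter because \<open>active\<close> depends on it: the final proof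
  fixes one eigenvector in the box and uses the exported facts at all others.\<close>

locale positive_eigenvector =
  fixes A :: "real mat" and l :: real and n :: nat and x :: "real vec"
  assumes A: "A \<in> nonneg_mats n n"
    and l: "0 < l"
    and x: "x \<in> eigencone A l"
    and pos: "\<And>i. i < n \<Longrightarrow> 0 < x $ i"
begin

lemma dims [simp]: "dim_row A = n" "dim_col A = n" "dim_vec x = n"
  using A x by (auto simp: nonneg_mats_def eigencone_def nonneg_vecs_def)

lemma A_nonneg: "i < n \<Longrightarrow> j < n \<Longrightarrow> 0 \<le> A $$ (i, j)"
  using A by (simp add: nonneg_mats_def)

lemma mult_x: "max_mult_vec A x = l \<cdot>\<^sub>v x"
  using x by (simp add: eigencone_def)

lemma row_max: "i < n \<Longrightarrow> max_sum n (\<lambda>j. A $$ (i, j) * x $ j) = l * x $ i"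
  using arg_cong[OF mult_x, of "\<lambda>v. v $ i"] by simp

lemma row_le: "i < n \<Longrightarrow> j < n \<Longrightarrow> A $$ (i, j) * x $ j \<le> l * x $ i"
  using max_sum_upper[of j n "\<lambda>j. A $$ (i, j) * x $ j"] row_max by simp

text \<open>Known in max algebra as the saturation graph of \<open>x\<close>.\<close>

definition active :: "(nat \<times> nat) set" where
  "active = {(i, j). i < n \<and> j < n \<and> A $$ (i, j) * x $ j = l * x $ i}"

lemma activeD:
  assumes "(i, j) \<in> active"
  shows "i < n" "j < n" "A $$ (i, j) * x $ j = l * x $ i" "0 < A $$ (i, j)"
proof -
  from assms show *: "i < n" "j < n" "A $$ (i, j) * x $ j = l * x $ i" by (auto simp: active_def)
  then have "0 < A $$ (i, j) * x $ j" using l pos by simp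
  then show "0 < A $$ (i, j)" using pos[OF *(2)] by (simp add: zero_less_mult_iff)
qed

lemma inactive_less:
  "i < n \<Longrightarrow> j < n \<Longrightarrow> (i, j) \<notin> active \<Longrightarrow> A $$ (i, j) * x $ j < l * x $ i"
  using row_le[of i j] by (auto simp: active_def)

lemma row_active: "i < n \<Longrightarrow> \<exists>j. (i, j) \<in> active"
  using max_sum_attained[OF row_max[of i]] l pos[of i] by (auto simp: active_def)

text \<open>The rows in which a given column is active form a set, and these sets cover all rows by
  \<open>row_active\<close>. The condition says that the cover is minimal, the classical criterion
  for unique solvability of a max-linear system.\<close>

definition private_rows :: bool where
  "private_rows \<longleftrightarrow> (\<forall>i<n. \<exists>k<n. \<forall>j. (k, j) \<in> active \<longleftrightarrow> j = i)"

lemma not_private_rows: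
  assumes "\<not> private_rows"
  obtains i where "i < n" "\<And>k. k < n \<Longrightarrow> \<exists>j. j \<noteq> i \<and> (k, j) \<in> active"
proof -
  from assms obtain i where i: "i < n" "\<And>k. k < n \<Longrightarrow> \<not> (\<forall>j. (k, j) \<in> active \<longleftrightarrow> j = i)"
    unfolding private_rows_def by blast
  show thesis
  proof (rule that[OF i(1)])
    fix k assume k: "k < n"
    from row_active[OF k] i(2)[OF k] show "\<exists>j. j \<noteq> i \<and> (k, j) \<in> active" by auto
  qed
qed

text \<open>Every row keeps an active column other than \<open>i\<close>, which still attains its
  maximum, and lowering entry \<open>i\<close> cannot raise any row.\<close>

lemma mult_lowered:
  assumes i: "i < n" "\<And>k. k < n \<Longrightarrow> \<exists>j. j \<noteq> i \<and> (k, j) \<in> active"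
    and y: "dim_vec y = n" "\<And>j. j < n \<Longrightarrow> j \<noteq> i \<Longrightarrow> y $ j = x $ j" "y $ i \<le> x $ i"
  shows "max_mult_vec A y = l \<cdot>\<^sub>v x"
proof (rule eq_vecI)
  fix k assume "k < dim_vec (l \<cdot>\<^sub>v x)"
  then have k: "k < n" by simp
  obtain j where j: "j \<noteq> i" "(k, j) \<in> active" using i(2)[OF k] by blast
  have "max_sum n (\<lambda>j. A $$ (k, j) * y $ j) = l * x $ k"
  proof (rule max_sum_eqI)
    fix m assume m: "m < n"
    have "A $$ (k, m) * y $ m \<le> A $$ (k, m) * x $ m"
      using y m A_nonneg[OF k m] by (cases "m = i") (auto intro: mult_left_mono)
    then show "A $$ (k, m) * y $ m \<le> l * x $ k" using row_le[OF k m] by simp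
  next
    show "A $$ (k, j) * y $ j = l * x $ k" using activeD(2,3)[OF j(2)] j(1) y(2) by simp
  qed (use activeD(2)[OF j(2)] l pos[OF k] in auto)
  then show "max_mult_vec A y $ k = (l \<cdot>\<^sub>v x) $ k" using k by simp
qed simp

text \<open>Every column is active in some row, which bounds \<open>y\<close> above by
  \<open>x\<close>. The maximum in the private row of column \<open>i\<close> must then be attained
  at column \<open>i\<close> with the full value \<open>x $ i\<close>.\<close>

lemma private_rows_unique:
  assumes "private_rows" and y: "dim_vec y = n" "max_mult_vec A y = l \<cdot>\<^sub>v x"
  shows "y = x"
proof (rule eq_vecI)
  have row: "max_sum n (\<lambda>j. A $$ (k, j) * y $ j) = l * x $ k" if "k < n" for k
    using arg_cong[OF y(2), of "\<lambda>v. v $ k"] that by simp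
  have le: "A $$ (k, j) * y $ j \<le> l * x $ k" if "k < n" "j < n" for k j
    using max_sum_upper[OF that(2), of "\<lambda>j. A $$ (k, j) * y $ j"] row[OF that(1)] by simp
  have priv: "\<exists>k<n. \<forall>j. (k, j) \<in> active \<longleftrightarrow> j = i" if "i < n" for i
    using assms(1) that by (simp add: private_rows_def)
  have upper: "y $ i \<le> x $ i" if i: "i < n" for i
  proof -
    obtain k where k: "k < n" "(k, i) \<in> active" using priv[OF i] by blast
    then have "A $$ (k, i) * y $ i \<le> A $$ (k, i) * x $ i"
      using le[OF k(1) i] activeD by simp
    then show ?thesis using activeD(4)[OF k(2)] by simp
  qed
  fix i assume "i < dim_vec x"
  then have i: "i < n" by simp
  obtain k where k: "k < n" "\<And>j. (k, j) \<in> active \<longleftrightarrow> j = i" using priv[OF i] by blast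
  obtain j where j: "j < n" "A $$ (k, j) * y $ j = l * x $ k"
    using max_sum_attained[OF row[OF k(1)]] l pos[OF k(1)] by auto
  have "A $$ (k, j) * y $ j \<le> A $$ (k, j) * x $ j"
    using upper[OF j(1)] A_nonneg[OF k(1) j(1)] by (rule mult_left_mono)
  \<comment> \<open>Replacing \<open>y $ j\<close> by the larger \<open>x $ j\<close> keeps the term
    at least \<open>l * x $ k\<close>, which an inactive pair cannot reach.\<close>
  then have "(k, j) \<in> active" using inactive_less[OF k(1) j(1)] j by force
  then have ji: "j = i" using k by blast
  then have "A $$ (k, i) * y $ i = A $$ (k, i) * x $ i" "0 < A $$ (k, i)"
    using j(2) activeD(3,4)[of k i] k(2)[of i] by auto
  then show "y $ i = x $ i" by simp
qed (simp add: y(1))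

lemma private_rows_iff: "private_rows \<longleftrightarrow> (\<forall>i<n. x \<notin> max_span (remove_col A i))"
proof
  assume priv: "private_rows"
  show "\<forall>i<n. x \<notin> max_span (remove_col A i)"
  proof (intro allI impI notI)
    fix i assume i: "i < n" and "x \<in> max_span (remove_col A i)"
    then obtain z where z: "z \<in> nonneg_vecs n" "z $ i = 0" "x = max_mult_vec A z"
      using mem_max_span_remove_col_iff[of i A x] by auto
    have [simp]: "dim_vec z = n" using z(1) by (auto simp: nonneg_vecs_def)
    have "max_mult_vec A (l \<cdot>\<^sub>v z) = l \<cdot>\<^sub>v x"
    proof (rule eq_vecI)
      fix k assume "k < dim_vec (l \<cdot>\<^sub>v x)"
      then have k: "k < n" by simp
      have xk: "max_sum n (\<lambda>j. A $$ (k, j) * z $ j) = x $ k"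
        using k arg_cong[OF z(3), of "\<lambda>v. v $ k"] by simp
      then obtain j where j: "j < n" "A $$ (k, j) * z $ j = x $ k"
        using max_sum_attained pos[OF k] by blast
      have "max_sum n (\<lambda>j. A $$ (k, j) * (l * z $ j)) = l * x $ k"
      proof (rule max_sum_eqI)
        fix m assume "m < n"
        then have "A $$ (k, m) * z $ m \<le> x $ k"
          using max_sum_upper[of m n "\<lambda>j. A $$ (k, j) * z $ j"] xk by simp
        then show "A $$ (k, m) * (l * z $ m) \<le> l * x $ k" using l by (simp add: mult.left_commute)
      qed (use j l pos[OF k] in \<open>auto simp: mult.left_commute\<close>)
      moreover have "max_sum n (\<lambda>j. A $$ (k, j) * (l \<cdot>\<^sub>v z) $ j) = max_sum n (\<lambda>j. A $$ (k, j) * (l * z $ j))"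
        by (rule max_sum_cong) simp
      ultimately show "max_mult_vec A (l \<cdot>\<^sub>v z) $ k = (l \<cdot>\<^sub>v x) $ k" using k by simp
    qed simp
    then have "l \<cdot>\<^sub>v z = x" by (intro private_rows_unique[OF priv]) simp_all
    then have "x $ i = (l \<cdot>\<^sub>v z) $ i" by simp
    also have "\<dots> = 0" using z(2) i by simp
    finally have "x $ i = 0" .
    then show False using pos[OF i] by simp
  qed
next
  assume span: "\<forall>i<n. x \<notin> max_span (remove_col A i)"
  show "private_rows"
  proof (rule ccontr)
    assume "\<not> private_rows"
    then obtain i where i: "i < n" "\<And>k. k < n \<Longrightarrow> \<exists>j. j \<noteq> i \<and> (k, j) \<in> active"
      using not_private_rows by blast
    define z where "z = vec n (\<lambda>j. if j = i then 0 else x $ j / l)"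
    have "max_mult_vec A z = x"
    proof (rule eq_vecI)
      fix k assume "k < dim_vec x"
      then have k: "k < n" by simp
      obtain j where j: "j \<noteq> i" "(k, j) \<in> active" using i(2)[OF k] by blast
      have "max_sum n (\<lambda>j. A $$ (k, j) * z $ j) = x $ k"
      proof (rule max_sum_eqI)
        fix m assume m: "m < n"
        then show "A $$ (k, m) * z $ m \<le> x $ k"
          using row_le[OF k m] l pos[OF k] by (auto simp: z_def field_simps)
      next
        show "A $$ (k, j) * z $ j = x $ k"
          using activeD[OF j(2)] j(1) l by (auto simp: z_def field_simps)
      qed (use activeD[OF j(2)] pos[OF k] in auto)
      then show "max_mult_vec A z $ k = x $ k" using k by simp
    qed simp
    moreover have "z \<in> nonneg_vecs n" "z $ i = 0"
      using i(1) l pos by (auto simp: z_def nonneg_vecs_def less_imp_le)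
    ultimately have "x \<in> max_span (remove_col A i)"
      using mem_max_span_remove_col_iff[of i A x] i(1) by auto
    then show False using span i(1) by blast
  qed
qed

text \<open>A row is private to at most one column, so choosing a private row for each column is an
  injection of a finite set into itself. Hence all rows are private, and \<open>\<sigma>\<close> is
  the inverse of the choice.\<close>

lemma private_rows_permutation:
  assumes "private_rows"
  shows "\<exists>\<sigma>. bij_betw \<sigma> {..<n} {..<n} \<and> (\<forall>k<n. \<forall>j. (k, j) \<in> active \<longleftrightarrow> j = \<sigma> k)"
proof -
  obtain \<tau> where \<tau>: "\<And>i. i < n \<Longrightarrow> \<tau> i < n" "\<And>i j. i < n \<Longrightarrow> (\<tau> i, j) \<in> active \<longleftrightarrow> j = i"
    using assms unfolding private_rows_def by metis
  have "inj_on \<tau> {..<n}" by (rule inj_onI) (metis \<tau>(2) lessThan_iff)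
  moreover have "\<tau> ` {..<n} \<subseteq> {..<n}" using \<tau>(1) by auto
  ultimately have bij: "bij_betw \<tau> {..<n} {..<n}"
    by (simp add: bij_betw_def endo_inj_surj)
  show ?thesis
  proof (intro exI conjI allI impI)
    show "bij_betw (inv_into {..<n} \<tau>) {..<n} {..<n}" by (rule bij_betw_inv_into[OF bij])
    fix k j assume "k < n"
    then obtain i where "i < n" "k = \<tau> i" using bij by (auto simp: bij_betw_def)
    then show "(k, j) \<in> active \<longleftrightarrow> j = inv_into {..<n} \<tau> k"
      using \<tau>(2) bij by (simp add: bij_betw_def inv_into_f_f)
  qed
qed

text \<open>The set of nodes reachable from \<open>j\<close> is mapped into itself by the
  permutation, hence onto itself by finiteness. It therefore contains the preimage of
  \<open>j\<close>, which is \<open>k\<close>.\<close>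

lemma private_rows_return:
  assumes "private_rows" "(k, j) \<in> active"
  shows "(j, k) \<in> active\<^sup>*"
proof -
  obtain \<sigma> where \<sigma>: "bij_betw \<sigma> {..<n} {..<n}" "\<And>k j. k < n \<Longrightarrow> (k, j) \<in> active \<longleftrightarrow> j = \<sigma> k"
    using private_rows_permutation[OF assms(1)] by auto
  let ?R = "{v. (j, v) \<in> active\<^sup>*}"
  have sub: "?R \<subseteq> {..<n}"
    using activeD(2)[OF assms(2)] by (auto elim: rtranclE dest: activeD)
  then have inj: "inj_on \<sigma> ?R" using \<sigma>(1) inj_on_subset by (auto simp: bij_betw_def)
  have "\<sigma> ` ?R \<subseteq> ?R" using sub \<sigma>(2) by (auto intro: rtrancl_into_rtrancl)
  with inj sub have "\<sigma> ` ?R = ?R" by (meson endo_inj_surj finite_lessThan finite_subset)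
  moreover have "j \<in> ?R" by simp
  ultimately obtain u where u: "u \<in> ?R" "j = \<sigma> u" by blast
  have k: "k < n" by (rule activeD(1)[OF assms(2)])
  with \<sigma>(2) assms(2) u have "\<sigma> u = \<sigma> k" by blast
  then have "u = k" using u k sub bij_betw_imp_inj_on[OF \<sigma>(1)] by (auto dest: inj_onD)
  then show ?thesis using u by simp
qed

end

section \<open>The critical graph\<close>

text \<open>All factors are positive, so a strict inequality in one place could not be compensated
  elsewhere. Positivity and monotonicity are carried along because the induction step uses them for
  the remaining list.\<close>

lemma prod_list_le_eq:
  fixes f g :: "'a \<Rightarrow> 'b::linordered_field"
  assumes "\<And>e. e \<in> set c \<Longrightarrow> 0 < f e \<and> f e \<le> g e"
  shows "0 < (\<Prod>e\<leftarrow>c. f e) \<and> (\<Prod>e\<leftarrow>c. f e) \<le> (\<Prod>e\<leftarrow>c. g e) \<and>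
    ((\<Prod>e\<leftarrow>c. f e) = (\<Prod>e\<leftarrow>c. g e) \<longrightarrow> (\<forall>e \<in> set c. f e = g e))"
  using assms
proof (induction c)
  case (Cons a c)
  let ?F = "\<Prod>e\<leftarrow>c. f e" and ?G = "\<Prod>e\<leftarrow>c. g e"
  have IH: "0 < ?F" "?F \<le> ?G" "?F = ?G \<longrightarrow> (\<forall>e \<in> set c. f e = g e)"
    using Cons.IH Cons.prems by auto
  have a: "0 < f a" "f a \<le> g a" using Cons.prems by auto
  have le: "f a * ?F \<le> g a * ?F" "g a * ?F \<le> g a * ?G" using a IH by simp_all
  have eq: "f a = g a \<and> ?F = ?G" if "f a * ?F = g a * ?G"
  proof -
    have "f a * ?F = g a * ?F" "g a * ?F = g a * ?G"
      using le that by linarith+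
    then show ?thesis using a IH(1) by auto
  qed
  have "0 < f a * ?F" "f a * ?F \<le> g a * ?G" using a(1) IH(1) order_trans[OF le] by auto
  moreover have "\<forall>e \<in> set (a # c). f e = g e" if "f a * ?F = g a * ?G"
    using eq[OF that] IH(3) by auto
  ultimately show ?case unfolding list.map(2) prod_list.Cons by blast
qed simp

lemma prod_list_mult_distrib:
  fixes f g :: "'a \<Rightarrow> 'b::comm_monoid_mult"
  shows "(\<Prod>e\<leftarrow>c. f e * g e) = (\<Prod>e\<leftarrow>c. f e) * (\<Prod>e\<leftarrow>c. g e)"
  by (induction c) (auto simp: mult_ac)

context positive_eigenvector
begin

text \<open>The vector picked by \<open>SOME\<close> need not be \<open>x\<close>, but its support
  must contain that of \<open>x\<close>, which is everything.\<close>

lemma eigen_supp_eq: "eigen_supp A l = {..<n}"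
proof -
  let ?P = "\<lambda>x'. x' \<in> eigencone A l \<and> (\<forall>x \<in> eigencone A l. supp x \<subseteq> supp x')"
  have supp_x: "supp x = {..<n}" using pos by (auto simp: supp_def)
  have sub: "supp y \<subseteq> {..<n}" if "y \<in> eigencone A l" for y
    using that by (auto simp: eigencone_def nonneg_vecs_def supp_def)
  have "?P x" using x supp_x sub by simp
  then have "?P (SOME x'. ?P x')" by (rule someI)
  then have "supp (SOME x'. ?P x') = {..<n}" using x supp_x sub by blast
  then show ?thesis by (simp add: eigen_supp_def)
qed

abbreviation crit :: "(nat \<times> nat) set" where
  "crit \<equiv> parcs (critical_graph A l)"

text \<open>Multiply the inequalities \<open>row_le\<close> around the cycle. The entries of
  \<open>x\<close> cancel and the cycle product is \<open>l ^ length c\<close>, so the products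
  agree, which forces equality in each factor.\<close>

lemma critical_cycle_active:
  assumes "c \<in> critical_cycles A l"
  shows "set c \<subseteq> active"
proof -
  from assms have cyc: "pre_digraph.cycle (with_proj (mat_digraph A)) c"
    and mean: "root (length c) (\<Prod>e\<leftarrow>c. A $$ e) = l"
    by (auto simp: critical_cycles_def cycle_geo_mean_def)
  have arc: "fst e < n" "snd e < n" "0 < A $$ e" if "e \<in> set c" for e
    using cycle_arcs[OF cyc] that by (auto simp: mat_digraph_def)
  have "0 \<le> (\<Prod>e\<leftarrow>c. A $$ e)"
    using arc(3) by (intro prod_list_nonneg) (auto simp: less_imp_le)
  then have prod: "(\<Prod>e\<leftarrow>c. A $$ e) = l ^ length c"
    using mean cycle_not_Nil[OF cyc] by (metis length_greater_0_conv real_root_pow_pos2)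
  have "(\<Prod>e\<leftarrow>c. A $$ e * x $ snd e) = l ^ length c * (\<Prod>e\<leftarrow>c. x $ snd e)"
    by (simp add: prod_list_mult_distrib prod)
  also have "(\<Prod>e\<leftarrow>c. x $ snd e) = (\<Prod>e\<leftarrow>c. x $ fst e)"
    by (rule cycle_prod_list[OF cyc]) (use pos arc in force)
  also have "l ^ length c * \<dots> = (\<Prod>e\<leftarrow>c. l * x $ fst e)"
    by (simp add: prod_list_mult_distrib map_replicate_const)
  finally have "(\<Prod>e\<leftarrow>c. A $$ e * x $ snd e) = (\<Prod>e\<leftarrow>c. l * x $ fst e)" .
  moreover have "0 < A $$ e * x $ snd e \<and> A $$ e * x $ snd e \<le> l * x $ fst e" if "e \<in> set c" for e
    using arc[OF that] pos row_le[of "fst e" "snd e"] by simp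
  ultimately have "\<forall>e \<in> set c. A $$ e * x $ snd e = l * x $ fst e"
    using prod_list_le_eq[of c "\<lambda>e. A $$ e * x $ snd e" "\<lambda>e. l * x $ fst e"] by blast
  then show ?thesis using arc by (auto simp: active_def)
qed

text \<open>The arc closes an elementary active path from \<open>j\<close> back to \<open>k\<close>.
  Around the resulting cycle the equalities of the active arcs multiply to
  \<open>l ^ length c\<close>, so its mean is \<open>l\<close>.\<close>

lemma active_cycle_critical:
  assumes arc: "(k, j) \<in> active" and path: "(j, k) \<in> active\<^sup>*"
  shows "\<exists>c \<in> critical_cycles A l. (k, j) \<in> set c"
proof -
  \<comment> \<open>An auxiliary digraph with the active arcs, which makes the library's reduction
    of reachability to an elementary path available.\<close>
  define D where "D = \<lparr>pverts = {..<n}, parcs = active\<rparr>"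
  interpret D: pair_wf_digraph D
    by unfold_locales (auto simp: D_def dest: activeD)
  have "j \<rightarrow>\<^sup>*\<^bsub>with_proj D\<^esub> k"
    using path activeD(1,2)[OF arc] unfolding D.reachable_conv by (simp add: D_def)
  then obtain p where "D.apath j p k" using D.reachable_apath by blast
  then have p: "set p \<subseteq> active" "pcas j p k" "distinct (pawalk_verts j p)"
    unfolding D.apath_def D.awalk_def by (simp_all add: D_def)
  define c where "c = (k, j) # p"
  have sub: "set c \<subseteq> active" using p arc by (auto simp: c_def)
  have cyc: "pre_digraph.cycle (with_proj (mat_digraph A)) c"
    unfolding cycle_with_proj_iff
  proof (intro bexI conjI)
    show "set c \<subseteq> parcs (mat_digraph A)" using sub by (auto simp: mat_digraph_def dest: activeD)
    show "k \<in> pverts (mat_digraph A)" using activeD(1)[OF arc] by (simp add: mat_digraph_def)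
  qed (use p in \<open>auto simp: c_def\<close>)
  have "A $$ e * x $ snd e = l * x $ fst e" "0 < x $ fst e" "0 < x $ snd e" if "e \<in> set c" for e
    using that sub activeD[of "fst e" "snd e"] pos by auto
  note e = this
  have "(\<Prod>e\<leftarrow>c. A $$ e) * (\<Prod>e\<leftarrow>c. x $ snd e) = (\<Prod>e\<leftarrow>c. A $$ e * x $ snd e)"
    by (simp add: prod_list_mult_distrib)
  also have "\<dots> = (\<Prod>e\<leftarrow>c. l * x $ fst e)"
    using e(1) by (intro arg_cong[where f = prod_list] map_cong) auto
  also have "\<dots> = l ^ length c * (\<Prod>e\<leftarrow>c. x $ fst e)"
    by (simp add: prod_list_mult_distrib map_replicate_const)
  also have "(\<Prod>e\<leftarrow>c. x $ fst e) = (\<Prod>e\<leftarrow>c. x $ snd e)"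
    by (rule cycle_prod_list[OF cyc, symmetric]) (use e in force)
  finally have "(\<Prod>e\<leftarrow>c. A $$ e) = l ^ length c"
    using e(3) by (simp add: prod_list_zero_iff) force
  then have "cycle_geo_mean A c = l"
    using l cycle_not_Nil[OF cyc] by (simp add: cycle_geo_mean_def real_root_power_cancel)
  moreover have "cycle_nodes c \<subseteq> eigen_supp A l"
    unfolding eigen_supp_eq cycle_nodes_def
  proof (rule image_subsetI)
    fix e assume "e \<in> set c"
    with sub activeD(1)[of "fst e" "snd e"] show "fst e \<in> {..<n}" by auto
  qed
  ultimately show ?thesis using cyc by (auto simp: critical_cycles_def c_def)
qed

lemma crit_subset_active: "crit \<subseteq> active"
  using critical_cycle_active by (auto simp: critical_graph_def)

lemma active_return_crit: "(k, j) \<in> active \<Longrightarrow> (j, k) \<in> active\<^sup>* \<Longrightarrow> (k, j) \<in> crit"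
  using active_cycle_critical by (auto simp: critical_graph_def)

lemma critical_cycle_cycle: "c \<in> critical_cycles A l \<Longrightarrow> pre_digraph.cycle (with_proj (mat_digraph A)) c"
  by (simp add: critical_cycles_def)

lemma crit_return: "(k, j) \<in> crit \<Longrightarrow> (j, k) \<in> crit\<^sup>*"
proof -
  assume "(k, j) \<in> crit"
  then obtain c where c: "c \<in> critical_cycles A l" "(k, j) \<in> set c"
    by (auto simp: critical_graph_def)
  note cyc = critical_cycle_cycle[OF c(1)]
  have "j \<in> fst ` set c" "k \<in> fst ` set c"
    using c(2) cycle_heads[OF cyc] by force+
  then have "(j, k) \<in> (set c)\<^sup>*" by (rule cycle_connected[OF cyc])
  moreover have "set c \<subseteq> crit" using c(1) by (auto simp: critical_graph_def)
  ultimately show ?thesis using rtrancl_mono by blast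
qed

text \<open>Each critical arc can be undone along a critical cycle through it, so one-way
  reachability already means membership in the same component.\<close>

lemma crit_rtrancl_sym: "(i, j) \<in> crit\<^sup>* \<Longrightarrow> (j, i) \<in> crit\<^sup>*"
  by (induction rule: rtrancl_induct) (auto intro: crit_return rtrancl_trans)

lemma critical_nodes_tails: "critical_nodes A l = fst ` crit"
  by (auto simp: critical_nodes_def critical_graph_def cycle_nodes_def image_UN)

lemma critical_nodes_heads: "critical_nodes A l = snd ` crit"
proof -
  have "snd ` crit = (\<Union>c \<in> critical_cycles A l. snd ` set c)"
    by (simp add: critical_graph_def image_UN)
  also have "\<dots> = (\<Union>c \<in> critical_cycles A l. fst ` set c)"
    using cycle_heads[OF critical_cycle_cycle] by simp
  also have "\<dots> = critical_nodes A l" by (simp add: critical_nodes_def critical_graph_def cycle_nodes_def)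
  finally show ?thesis ..
qed

lemma critical_nodes_subset: "critical_nodes A l \<subseteq> {..<n}"
  unfolding critical_nodes_tails by (force dest: subsetD[OF crit_subset_active] activeD)

lemma pair_fin_digraph_critical_graph: "pair_fin_digraph (critical_graph A l)"
proof
  show "fst e \<in> pverts (critical_graph A l)" if "e \<in> crit" for e
    using that by (simp flip: critical_nodes_def add: critical_nodes_tails)
  show "snd e \<in> pverts (critical_graph A l)" if "e \<in> crit" for e
    using that by (simp flip: critical_nodes_def add: critical_nodes_heads)
  show "finite (pverts (critical_graph A l))"
    using critical_nodes_subset finite_subset by (auto simp flip: critical_nodes_def)
  have "crit \<subseteq> {..<n} \<times> {..<n}" by (auto dest: subsetD[OF crit_subset_active] activeD)
  then show "finite crit" by (rule finite_subset) simp
qed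

lemma critical_graph_cycle:
  assumes "c \<in> critical_cycles A l"
  shows "pre_digraph.cycle (with_proj (critical_graph A l)) c"
proof -
  obtain u where u: "pcas u c u" "distinct (tl (pawalk_verts u c))" "c \<noteq> []"
    using critical_cycle_cycle[OF assms] by (auto simp: cycle_with_proj_iff)
  then have "u \<in> cycle_nodes c" by (cases c) (auto simp: cycle_nodes_def)
  then show ?thesis
    using u assms unfolding cycle_with_proj_iff by (auto simp: critical_graph_def)
qed

text \<open>\<open>critical_cycles\<close> contains all rotations of a cycle, so one list per node
  set is selected. Single-valuedness makes node sets equal or disjoint and recovers the arcs of a
  cycle from its nodes.\<close>

lemma single_valued_crit_disjoint_cycles:
  assumes sv: "single_valued crit"
  shows "\<exists>cs. consists_of_disjoint_cycles (critical_graph A l) cs"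
proof -
  let ?C = "critical_cycles A l"
  have "cycle_nodes ` ?C \<subseteq> Pow {..<n}"
    using critical_cycle_active by (force simp: cycle_nodes_def dest: activeD)
  then have "finite (cycle_nodes ` ?C)" by (rule finite_subset) simp
  then obtain Ss where Ss: "set Ss = cycle_nodes ` ?C" "distinct Ss"
    using finite_distinct_list by blast
  define cs where "cs = map (inv_into ?C cycle_nodes) Ss"
  have inv: "inv_into ?C cycle_nodes S \<in> ?C" "cycle_nodes (inv_into ?C cycle_nodes S) = S"
    if "S \<in> set Ss" for S
    using that Ss(1) by (auto simp: inv_into_into f_inv_into_f)
  have cs_sub: "set cs \<subseteq> ?C" using inv(1) by (auto simp: cs_def)
  have closed: "v \<in> cycle_nodes c" if "c \<in> ?C" "u \<in> cycle_nodes c" "(u, v) \<in> crit\<^sup>*" for c u v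
    using single_valued_cycle_closed[OF sv critical_graph_cycle[OF that(1)] that(3,2)] .
  have conn: "(u, v) \<in> crit\<^sup>*" if "c \<in> ?C" "u \<in> cycle_nodes c" "v \<in> cycle_nodes c" for c u v
    using cycle_connected[OF critical_graph_cycle[OF that(1)], of u v] that
      rtrancl_mono[OF cycle_arcs[OF critical_graph_cycle[OF that(1)]]]
    by (auto simp: cycle_nodes_def)
  have same: "cycle_nodes c = cycle_nodes d" if "c \<in> ?C" "d \<in> ?C" "u \<in> cycle_nodes c" "u \<in> cycle_nodes d" for c d u
    using closed conn that by (meson subsetI subset_antisym)
  have arcs: "set c = {e \<in> crit. fst e \<in> cycle_nodes c}" if "c \<in> ?C" for c
  proof (intro equalityI subsetI)
    fix e assume "e \<in> {e \<in> crit. fst e \<in> cycle_nodes c}"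
    then obtain e' where "e' \<in> set c" "fst e' = fst e" "e \<in> crit" by (auto simp: cycle_nodes_def)
    moreover from this have "e' \<in> crit" using cycle_arcs[OF critical_graph_cycle[OF that]] by blast
    ultimately show "e \<in> set c" using sv by (metis prod.collapse single_valuedD)
  qed (use cycle_arcs[OF critical_graph_cycle[OF that]] in \<open>auto simp: cycle_nodes_def\<close>)
  have nodes_cs: "cycle_nodes ` set cs = cycle_nodes ` ?C"
    using inv(2) Ss(1) by (force simp: cs_def image_image)
  have "consists_of_disjoint_cycles (critical_graph A l) cs"
    unfolding consists_of_disjoint_cycles_def
  proof (intro conjI ballI allI impI)
    fix s t assume st: "s < length cs" "t < length cs" "s \<noteq> t"
    then have "cycle_nodes (cs ! s) \<noteq> cycle_nodes (cs ! t)"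
      using inv(2) Ss(2) by (simp add: cs_def nth_eq_iff_index_eq)
    moreover have "cs ! s \<in> ?C" "cs ! t \<in> ?C" using cs_sub st by (meson nth_mem subsetD)+
    ultimately show "cycle_nodes (cs ! s) \<inter> cycle_nodes (cs ! t) = {}"
      using same by blast
  next
    show verts: "pverts (critical_graph A l) = (\<Union>c \<in> set cs. cycle_nodes c)"
      using nodes_cs by (simp add: critical_graph_def)
    have "crit = {e \<in> crit. fst e \<in> pverts (critical_graph A l)}"
      using critical_nodes_tails by (auto simp: critical_nodes_def)
    also have "\<dots> = (\<Union>c \<in> set cs. {e \<in> crit. fst e \<in> cycle_nodes c})"
      by (auto simp: verts)
    also have "\<dots> = (\<Union>c \<in> set cs. set c)"
      by (rule SUP_cong) (use arcs cs_sub in auto)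
    finally show "crit = (\<Union>c \<in> set cs. set c)" .
  qed (use cs_sub critical_graph_cycle in auto)
  then show ?thesis ..
qed

text \<open>Restates the choice of representatives through reachability, so that no later proof has
  to mention strongly connected components.\<close>

lemma
  shows component_reps_critical: "r \<in> set (component_reps A l) \<Longrightarrow> r \<in> critical_nodes A l"
    and component_rep_exists:
      "i \<in> critical_nodes A l \<Longrightarrow> \<exists>r \<in> set (component_reps A l). (i, r) \<in> crit\<^sup>*"
    and component_reps_separated:
      "r \<in> set (component_reps A l) \<Longrightarrow> r' \<in> set (component_reps A l) \<Longrightarrow> (r, r') \<in> crit\<^sup>* \<Longrightarrow> r = r'"
proof -
  interpret G: pair_fin_digraph "critical_graph A l" by (rule pair_fin_digraph_critical_graph)
  have reach: "u \<rightarrow>\<^sup>*\<^bsub>with_proj (critical_graph A l)\<^esub> v \<longleftrightarrow> (u, v) \<in> crit\<^sup>* \<and> u \<in> critical_nodes A l" for u v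
    using G.reachable_conv[of u v] G.in_arcsD2
    by (auto simp: critical_nodes_def elim: rtranclE)
  have reps: "set (component_reps A l) = Min ` G.sccs_verts"
    by (simp add: component_reps_def G.finite_sccs_verts)
  have sub: "S \<subseteq> critical_nodes A l" if "S \<in> G.sccs_verts" for S
    using G.sccs_verts_subsets[OF that] by (simp add: critical_nodes_def)
  have Min: "Min S \<in> S" if "S \<in> G.sccs_verts" for S
  proof (rule Min_in)
    show "finite S" using sub[OF that] critical_nodes_subset by (meson finite_lessThan finite_subset)
    show "S \<noteq> {}" using that unfolding G.in_sccs_verts_conv_reachable by (elim conjE)
  qed
  show "r \<in> critical_nodes A l" if "r \<in> set (component_reps A l)" for r
  proof -
    from that reps obtain S where "S \<in> G.sccs_verts" "r = Min S" by auto
    with Min sub show ?thesis by blast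
  qed
  show "\<exists>r \<in> set (component_reps A l). (i, r) \<in> crit\<^sup>*" if "i \<in> critical_nodes A l" for i
  proof -
    have S: "G.scc_of i \<in> G.sccs_verts"
      using that by (intro G.scc_of_in_sccs_verts) (simp add: critical_nodes_def)
    have "(i, Min (G.scc_of i)) \<in> crit\<^sup>*"
      using Min[OF S] unfolding G.scc_of_def reach by blast
    then show ?thesis using S reps by auto
  qed
  show "r = r'" if "r \<in> set (component_reps A l)" "r' \<in> set (component_reps A l)" "(r, r') \<in> crit\<^sup>*" for r r'
  proof -
    from that(1) reps obtain S where S1: "S \<in> G.sccs_verts" "r = Min S" by auto
    from that(2) reps obtain S' where S2: "S' \<in> G.sccs_verts" "r' = Min S'" by auto
    note S = S1(1) S2(1) S1(2) S2(2)
    have "r' \<in> S"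
    proof (rule ccontr)
      assume "r' \<notin> S"
      moreover have r: "r \<in> S" "r' \<in> S'" using Min S by simp_all
      ultimately have "\<not> r \<rightarrow>\<^sup>*\<^bsub>with_proj (critical_graph A l)\<^esub> r' \<or> \<not> r' \<rightarrow>\<^sup>*\<^bsub>with_proj (critical_graph A l)\<^esub> r"
        using S(1) unfolding G.in_sccs_verts_conv_reachable by blast
      moreover have "r \<in> critical_nodes A l" "r' \<in> critical_nodes A l"
        using r sub[OF S(1)] sub[OF S(2)] by auto
      ultimately show False
        using that(3) crit_rtrancl_sym[OF that(3)] unfolding reach by blast
    qed
    moreover have "r' \<in> S'" using Min S by simp
    ultimately have "S = S'" using G.sccs_verts_disjoint[OF S(1,2)] by blast
    then show ?thesis using S by simp
  qed
qed

lemma private_rows_active_eq_crit: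
  assumes "private_rows"
  shows "active = crit"
proof (rule equalityI[OF subrelI crit_subset_active])
  fix k j assume "(k, j) \<in> active"
  then show "(k, j) \<in> crit" using active_return_crit private_rows_return[OF assms] by blast
qed

lemma private_rows_critical:
  assumes "private_rows"
  shows "critical_nodes A l = {..<n}" "single_valued crit"
proof -
  obtain \<sigma> where \<sigma>: "\<And>k j. k < n \<Longrightarrow> (k, j) \<in> active \<longleftrightarrow> j = \<sigma> k"
    using private_rows_permutation[OF assms] by auto
  have eq: "active = crit" by (rule private_rows_active_eq_crit[OF assms])
  show "single_valued crit"
  proof (rule single_valuedI)
    fix k i j assume "(k, i) \<in> crit" "(k, j) \<in> crit"
    then have "(k, i) \<in> active" "(k, j) \<in> active" by (simp_all add: eq)
    then show "i = j" using \<sigma> activeD(1) by metis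
  qed
  have "i \<in> fst ` crit" if "i < n" for i
  proof -
    from row_active[OF that] obtain j where "(i, j) \<in> crit" unfolding eq by blast
    then show ?thesis by (rule image_eqI[rotated]) simp
  qed
  then have "{..<n} \<subseteq> critical_nodes A l" unfolding critical_nodes_tails by blast
  with critical_nodes_subset show "critical_nodes A l = {..<n}" by (rule antisym)
qed

text \<open>Every node \<open>i\<close> is the head of a critical arc, whose tail is the private
  row: any other active arc from there would be a second critical arc.\<close>

lemma active_subset_crit_private_rows:
  assumes nodes: "critical_nodes A l = {..<n}" and sv: "single_valued crit"
    and sub: "active \<subseteq> crit"
  shows "private_rows"
  unfolding private_rows_def
proof (intro allI impI)
  fix i assume "i < n"
  then have "i \<in> critical_nodes A l" unfolding nodes by simp
  then have "i \<in> snd ` crit" by (simp only: critical_nodes_heads)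
  then obtain k where k: "(k, i) \<in> crit" by force
  then have "(k, i) \<in> active" using crit_subset_active by blast
  moreover have "j = i" if "(k, j) \<in> active" for j
  proof -
    from that sub have "(k, j) \<in> crit" by blast
    with sv k show ?thesis by (auto dest: single_valuedD)
  qed
  ultimately show "\<exists>k<n. \<forall>j. (k, j) \<in> active \<longleftrightarrow> j = i"
    using activeD(1)[of k i] by blast
qed

end

section \<open>The generating matrix\<close>

context positive_eigenvector
begin

section \<open>Powers of the scaled matrix and their supremum\<close>

abbreviation scaled_pow :: "nat \<Rightarrow> real mat" where
  "scaled_pow \<equiv> max_pow (scaled_mat A l)"

abbreviation scaled_closure :: "real mat" where
  "scaled_closure \<equiv> max_plus_closure (scaled_mat A l)"

lemma dim_scaled_mat [simp]: "dim_row (scaled_mat A l) = n" "dim_col (scaled_mat A l) = n"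
  by (simp_all add: scaled_mat_def)

lemma dim_pow [simp]: "dim_row (scaled_pow t) = n" "dim_col (scaled_pow t) = n"
  by (induction t) (simp_all add: max_mult_mat_def)

lemma dim_closure [simp]: "dim_row scaled_closure = n" "dim_col scaled_closure = n"
  by (simp_all add: max_plus_closure_def)

lemma index_pow_Suc:
  assumes "i < n" "j < n"
  shows "scaled_pow (Suc t) $$ (i, j) = max_sum n (\<lambda>k. A $$ (i, k) / l * scaled_pow t $$ (k, j))"
proof -
  have "scaled_pow (Suc t) $$ (i, j) = max_sum n (\<lambda>k. scaled_mat A l $$ (i, k) * scaled_pow t $$ (k, j))"
    using assms by (simp add: max_mult_mat_def)
  also have "\<dots> = max_sum n (\<lambda>k. A $$ (i, k) / l * scaled_pow t $$ (k, j))"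
    by (rule max_sum_cong) (use assms in \<open>simp add: scaled_mat_def eigen_supp_eq\<close>)
  finally show ?thesis .
qed

lemma pow_nonneg: "i < n \<Longrightarrow> j < n \<Longrightarrow> 0 \<le> scaled_pow t $$ (i, j)"
  by (cases t) (simp_all add: index_pow_Suc max_sum_nonneg del: max_pow.simps(2))

lemma pow_Suc_ge:
  "i < n \<Longrightarrow> j < n \<Longrightarrow> k < n \<Longrightarrow> A $$ (i, k) / l * scaled_pow t $$ (k, j) \<le> scaled_pow (Suc t) $$ (i, j)"
  unfolding index_pow_Suc by (rule max_sum_upper)

text \<open>The scaled matrix fixes \<open>x\<close>, hence so do its powers, and each single term
  of a max-product is at most the whole. This also bounds the suprema in
  \<open>max_plus_closure\<close>.\<close>

lemma pow_le: "i < n \<Longrightarrow> j < n \<Longrightarrow> scaled_pow t $$ (i, j) * x $ j \<le> x $ i"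
proof (induction t arbitrary: i)
  case 0
  then show ?case using pos by (simp add: less_imp_le)
next
  case (Suc t)
  have "scaled_pow (Suc t) $$ (i, j) \<le> x $ i / x $ j"
    unfolding index_pow_Suc[OF Suc.prems] max_sum_le_iff
  proof (intro conjI allI impI)
    show "0 \<le> x $ i / x $ j" using pos Suc.prems by (simp add: less_imp_le)
    fix k assume k: "k < n"
    have "A $$ (i, k) / l * scaled_pow t $$ (k, j) * x $ j \<le> A $$ (i, k) / l * x $ k"
      using Suc.IH[OF k Suc.prems(2)] A_nonneg[OF Suc.prems(1) k] l
      unfolding mult.assoc by (intro mult_left_mono) auto
    also have "\<dots> \<le> x $ i"
      using row_le[OF Suc.prems(1) k] l by (simp add: field_simps)
    finally show "A $$ (i, k) / l * scaled_pow t $$ (k, j) \<le> x $ i / x $ j"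
      using pos[OF Suc.prems(2)] by (simp add: pos_le_divide_eq)
  qed
  then show ?case using pos[OF Suc.prems(2)] by (simp add: pos_le_divide_eq del: max_pow.simps)
qed

lemma bdd_pow: "i < n \<Longrightarrow> j < n \<Longrightarrow> bdd_above ((\<lambda>t. scaled_pow t $$ (i, j)) ` {1..})"
  using pow_le pos by (intro bdd_aboveI2[of _ _ "x $ i / x $ j"]) (simp add: pos_le_divide_eq)

lemma pow_le_closure: "i < n \<Longrightarrow> j < n \<Longrightarrow> 1 \<le> t \<Longrightarrow> scaled_pow t $$ (i, j) \<le> scaled_closure $$ (i, j)"
  by (simp add: max_plus_closure_def) (rule cSUP_upper, use bdd_pow in auto)

lemma closure_leI:
  assumes "i < n" "j < n" "\<And>t. scaled_pow (Suc t) $$ (i, j) \<le> c"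
  shows "scaled_closure $$ (i, j) \<le> c"
proof -
  have "(SUP t\<in>{1..}. scaled_pow t $$ (i, j)) \<le> c"
  proof (rule cSUP_least)
    fix t :: nat assume "t \<in> {1..}"
    then show "scaled_pow t $$ (i, j) \<le> c" using assms(3)[of "t - 1"] by (simp del: max_pow.simps)
  qed simp
  then show ?thesis using assms by (simp add: max_plus_closure_def)
qed

lemma closure_nonneg: "i < n \<Longrightarrow> j < n \<Longrightarrow> 0 \<le> scaled_closure $$ (i, j)"
  using pow_nonneg pow_le_closure[of i j 1] by (meson le_numeral_extra(4) order_trans)

lemma closure_le: "i < n \<Longrightarrow> j < n \<Longrightarrow> scaled_closure $$ (i, j) * x $ j \<le> x $ i"
  using closure_leI[of i j "x $ i / x $ j"] pow_le[of i j] pos[of j]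
  by (simp add: pos_le_divide_eq del: max_pow.simps)

text \<open>
  Scaling row \<open>i\<close> by \<open>1 / x $ i\<close> and column \<open>j\<close> by \<open>x $ j\<close> turns \<open>A / l\<close> into a matrix with entries
  at most 1 whose entries 1 are the active arcs, so active walks attain the bound \<open>closure_le\<close>.
\<close>

lemma active_trancl_pow:
  assumes "(i, j) \<in> active\<^sup>+"
  shows "\<exists>t\<ge>1. scaled_pow t $$ (i, j) * x $ j = x $ i"
  using assms
proof (induction rule: converse_trancl_induct)
  case (base i)
  note ij = activeD[OF base]
  have "A $$ (i, j) / l * scaled_pow 0 $$ (j, j) \<le> scaled_pow (Suc 0) $$ (i, j)"
    using ij by (intro pow_Suc_ge)
  then have "A $$ (i, j) / l * x $ j \<le> scaled_pow (Suc 0) $$ (i, j) * x $ j"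
    using ij pos[of j] by (intro mult_right_mono) auto
  moreover have "A $$ (i, j) / l * x $ j = x $ i" using ij l by simp
  ultimately show ?case using pow_le[of i j "Suc 0"] ij by (intro exI[of _ "Suc 0"]) auto
next
  case (step i k)
  note ik = activeD[OF step.hyps(1)]
  have j: "j < n" using step.hyps(2) by (cases rule: trancl.cases) (auto dest: activeD)
  obtain t where t: "scaled_pow t $$ (k, j) * x $ j = x $ k" using step.IH by blast
  have "A $$ (i, k) / l * scaled_pow t $$ (k, j) * x $ j \<le> scaled_pow (Suc t) $$ (i, j) * x $ j"
    using ik j pos[OF j] by (intro mult_right_mono pow_Suc_ge) auto
  moreover have "A $$ (i, k) / l * scaled_pow t $$ (k, j) * x $ j = x $ i"
    unfolding mult.assoc t using ik l by simp
  ultimately show ?case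
    using pow_le[of i j "Suc t"] ik j by (intro exI[of _ "Suc t"]) (auto simp del: max_pow.simps)
qed

lemma active_trancl_closure:
  assumes "(i, j) \<in> active\<^sup>+"
  shows "scaled_closure $$ (i, j) * x $ j = x $ i"
proof -
  have ij: "i < n" "j < n"
    using assms by (auto elim: tranclE converse_tranclE dest: activeD)
  obtain t where t: "1 \<le> t" "scaled_pow t $$ (i, j) * x $ j = x $ i"
    using active_trancl_pow[OF assms] by blast
  have "x $ i \<le> scaled_closure $$ (i, j) * x $ j"
    unfolding t(2)[symmetric] using pos[OF ij(2)] t(1) ij
    by (intro mult_right_mono pow_le_closure) auto
  with closure_le[OF ij] show ?thesis by simp
qed

text \<open>Multiplying the closure by the scaled matrix collects the walks of length at least 2, so
  only the single arc into \<open>j\<close> is missing. The term for \<open>k = j\<close> restores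
  it because the diagonal entry is at least 1.\<close>

lemma closure_col_eigen:
  assumes i: "i < n" and j: "j < n" and diag: "1 \<le> scaled_closure $$ (j, j)"
  shows "max_sum n (\<lambda>k. A $$ (i, k) * scaled_closure $$ (k, j)) = l * scaled_closure $$ (i, j)"
proof (rule antisym)
  show "max_sum n (\<lambda>k. A $$ (i, k) * scaled_closure $$ (k, j)) \<le> l * scaled_closure $$ (i, j)"
    unfolding max_sum_le_iff
  proof (intro conjI allI impI)
    show "0 \<le> l * scaled_closure $$ (i, j)" using closure_nonneg[OF i j] l by simp
    fix k assume k: "k < n"
    show "A $$ (i, k) * scaled_closure $$ (k, j) \<le> l * scaled_closure $$ (i, j)"
    proof (cases "A $$ (i, k) = 0")
      case True
      then show ?thesis using closure_nonneg[OF i j] l by simp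
    next
      case False
      then have a: "0 < A $$ (i, k)" using A_nonneg[OF i k] by simp
      \<comment> \<open>Moving the positive entry to the other side leaves an upper bound for a
        supremum, which can be checked power by power.\<close>
      have "scaled_closure $$ (k, j) \<le> l * scaled_closure $$ (i, j) / A $$ (i, k)"
      proof (rule closure_leI[OF k j])
        fix t
        have "A $$ (i, k) / l * scaled_pow (Suc t) $$ (k, j) \<le> scaled_closure $$ (i, j)"
          using pow_Suc_ge[OF i j k, of "Suc t"] pow_le_closure[OF i j, of "Suc (Suc t)"] by simp
        then show "scaled_pow (Suc t) $$ (k, j) \<le> l * scaled_closure $$ (i, j) / A $$ (i, k)"
          using a l by (simp add: field_simps del: max_pow.simps)
      qed
      then show ?thesis using a by (simp add: field_simps)
    qed
  qed
  have "scaled_closure $$ (i, j) \<le> max_sum n (\<lambda>k. A $$ (i, k) * scaled_closure $$ (k, j)) / l"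
  proof (rule closure_leI[OF i j])
    fix t
    have "A $$ (i, k) / l * scaled_pow t $$ (k, j) \<le> max_sum n (\<lambda>k. A $$ (i, k) * scaled_closure $$ (k, j)) / l"
      if k: "k < n" for k
    proof -
      have "scaled_pow t $$ (k, j) \<le> scaled_closure $$ (k, j)"
      proof (cases t)
        case 0
        then show ?thesis using k j diag closure_nonneg[OF k j] by simp
      qed (use pow_le_closure[OF k j, of t] in simp)
      then have "A $$ (i, k) * scaled_pow t $$ (k, j) \<le> A $$ (i, k) * scaled_closure $$ (k, j)"
        using A_nonneg[OF i k] by (rule mult_left_mono)
      also have "\<dots> \<le> max_sum n (\<lambda>k. A $$ (i, k) * scaled_closure $$ (k, j))"
        using max_sum_upper[OF k, of "\<lambda>k. A $$ (i, k) * scaled_closure $$ (k, j)"] .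
      finally show ?thesis using l by (simp add: divide_right_mono)
    qed
    then show "scaled_pow (Suc t) $$ (i, j) \<le> max_sum n (\<lambda>k. A $$ (i, k) * scaled_closure $$ (k, j)) / l"
      unfolding index_pow_Suc[OF i j] max_sum_le_iff using l max_sum_nonneg by (simp add: less_imp_le)
  qed
  then show "l * scaled_closure $$ (i, j) \<le> max_sum n (\<lambda>k. A $$ (i, k) * scaled_closure $$ (k, j))"
    using l by (simp add: field_simps)
qed

text \<open>
  Every walk leaving an active-closed set uses an inactive arc, hence loses at least a fixed
  factor; the bound is uniform in the length of the walk, so it survives the supremum.
\<close>

lemma closure_gap:
  assumes S: "S \<subseteq> {..<n}" "\<And>i j. (i, j) \<in> active \<Longrightarrow> i \<in> S \<Longrightarrow> j \<in> S"
  obtains q where "q < 1" "\<And>i j. i \<in> S \<Longrightarrow> j < n \<Longrightarrow> j \<notin> S \<Longrightarrow> scaled_closure $$ (i, j) * x $ j \<le> q * x $ i"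
proof -
  \<comment> \<open>The normalised entries on arcs leaving \<open>S\<close>, all below 1 since
    \<open>S\<close> is closed under active arcs. The extra 0 keeps the maximum defined if there is
    no such arc, and makes \<open>q\<close> nonnegative.\<close>
  define Q where "Q = insert 0 ((\<lambda>(i, k). A $$ (i, k) * x $ k / (l * x $ i)) ` (S \<times> ({..<n} - S)))"
  have finS: "finite S" using S(1) finite_subset by blast
  have fin: "finite Q" unfolding Q_def using finS by simp
  define q where "q = Max Q"
  have "y < 1" if "y \<in> Q" for y
  proof -
    from that consider "y = 0" | i k where "i \<in> S" "k < n" "k \<notin> S" "y = A $$ (i, k) * x $ k / (l * x $ i)"
      unfolding Q_def by auto
    then show ?thesis
    proof cases
      case 2
      have i: "i < n" using S(1) 2(1) by auto
      have "A $$ (i, k) * x $ k < l * x $ i"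
        using inactive_less[OF i 2(2)] S(2) 2 by blast
      then show ?thesis using 2(4) l pos[OF i] by simp
    qed simp
  qed
  then have "q < 1" unfolding q_def using fin by (subst Max_less_iff) (auto simp: Q_def)
  have q0: "0 \<le> q" unfolding q_def using fin by (auto simp: Q_def)
  have exit: "A $$ (i, k) / l * x $ k \<le> q * x $ i" if "i \<in> S" "k < n" "k \<notin> S" for i k
  proof -
    have i: "i < n" using S(1) that by auto
    have "A $$ (i, k) * x $ k / (l * x $ i) \<le> q"
      unfolding q_def using fin that by (intro Max_ge) (auto simp: Q_def)
    then show ?thesis using l pos[OF i] by (simp add: field_simps)
  qed
  \<comment> \<open>Induction on the first arc of the walk: inside \<open>S\<close> the loss is
    still to come, and on leaving \<open>S\<close> the factor \<open>q\<close> is lost at once while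
    \<open>pow_le\<close> bounds the rest.\<close>
  have pow_gap: "scaled_pow t $$ (i, j) * x $ j \<le> q * x $ i" if "i \<in> S" "j < n" "j \<notin> S" for t i j
    using that
  proof (induction t arbitrary: i)
    case 0
    then have "i < n" "i \<noteq> j" using S(1) by auto
    then show ?case using 0 q0 pos[of i] by simp
  next
    case (Suc t)
    then have i: "i < n" and j: "j < n" using S(1) by auto
    have "scaled_pow (Suc t) $$ (i, j) \<le> q * x $ i / x $ j"
      unfolding index_pow_Suc[OF i j] max_sum_le_iff
    proof (intro conjI allI impI)
      show "0 \<le> q * x $ i / x $ j" using q0 pos[OF i] pos[OF j] by simp
      fix k assume k: "k < n"
      have a: "0 \<le> A $$ (i, k) / l" using A_nonneg[OF i k] l by simp
      have "A $$ (i, k) / l * (scaled_pow t $$ (k, j) * x $ j) \<le> q * x $ i"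
      proof (cases "k \<in> S")
        case True
        have "A $$ (i, k) / l * (scaled_pow t $$ (k, j) * x $ j) \<le> A $$ (i, k) / l * (q * x $ k)"
          using Suc.IH[OF True Suc.prems(2,3)] a by (rule mult_left_mono)
        also have "\<dots> = q * (A $$ (i, k) * x $ k / l)" by simp
        also have "\<dots> \<le> q * x $ i"
          using row_le[OF i k] l q0 by (intro mult_left_mono) (simp_all add: field_simps)
        finally show ?thesis .
      next
        case False
        have "A $$ (i, k) / l * (scaled_pow t $$ (k, j) * x $ j) \<le> A $$ (i, k) / l * x $ k"
          using pow_le[OF k j] a by (rule mult_left_mono)
        also have "\<dots> \<le> q * x $ i" using exit[OF Suc.prems(1) k False] .
        finally show ?thesis .
      qed
      then show "A $$ (i, k) / l * scaled_pow t $$ (k, j) \<le> q * x $ i / x $ j"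
        using pos[OF j] by (simp add: pos_le_divide_eq)
    qed
    then show ?case using pos[OF j] by (simp add: pos_le_divide_eq del: max_pow.simps)
  qed
  have "scaled_closure $$ (i, j) * x $ j \<le> q * x $ i" if "i \<in> S" "j < n" "j \<notin> S" for i j
  proof -
    have "i < n" using S(1) that by auto
    moreover have "scaled_pow (Suc t) $$ (i, j) \<le> q * x $ i / x $ j" for t
      using pow_gap[OF that, of "Suc t"] pos[OF that(2)] by (simp add: pos_le_divide_eq del: max_pow.simps)
    ultimately have "scaled_closure $$ (i, j) \<le> q * x $ i / x $ j" using that(2) by (intro closure_leI)
    then show ?thesis using pos[OF that(2)] by (simp add: pos_le_divide_eq)
  qed
  with \<open>q < 1\<close> show thesis by (rule that)
qed

section \<open>Columns of the generating matrix and their span\<close>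

abbreviation reps :: "nat list" where
  "reps \<equiv> component_reps A l"

lemma reps_less: "t < length reps \<Longrightarrow> reps ! t < n"
  using component_reps_critical[OF nth_mem] critical_nodes_subset by blast

lemma dim_generating_mat [simp]:
  "dim_row (generating_mat A l) = n" "dim_col (generating_mat A l) = length reps"
  by (simp_all add: generating_mat_def)

lemma index_generating_mat:
  "i < n \<Longrightarrow> t < length reps \<Longrightarrow> generating_mat A l $$ (i, t) = scaled_closure $$ (i, reps ! t)"
  using reps_less[of t] by (simp add: generating_mat_def mat_of_cols_index)

lemma generating_mat_nonneg: "generating_mat A l \<in> nonneg_mats n (length reps)"
  using closure_nonneg reps_less
  by (auto simp: nonneg_mats_def index_generating_mat intro!: carrier_matI)

text \<open>Runs once around a critical cycle through the representative. The walk has positive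
  length, as needed because the closure omits power 0.\<close>

lemma critical_trancl_rep:
  assumes "t < length reps"
  shows "(reps ! t, reps ! t) \<in> active\<^sup>+"
proof -
  have "reps ! t \<in> fst ` crit"
    using component_reps_critical[OF nth_mem[OF assms]] unfolding critical_nodes_tails .
  then obtain j where "(reps ! t, j) \<in> crit" by force
  then have "(reps ! t, reps ! t) \<in> crit\<^sup>+"
    using crit_return by (meson rtrancl_into_trancl2)
  then show ?thesis using crit_subset_active by (rule trancl_mono)
qed

lemma closure_rep_diag: "t < length reps \<Longrightarrow> scaled_closure $$ (reps ! t, reps ! t) = 1"
  using active_trancl_closure[OF critical_trancl_rep] pos[OF reps_less] by force

text \<open>The diagonal entry 1 at each representative makes every column an eigenvector, and max
  combinations preserve the eigenvalue equation.\<close>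

lemma span_generating_mat_eigencone:
  assumes z: "z \<in> nonneg_vecs (length reps)"
  shows "max_mult_vec (generating_mat A l) z \<in> eigencone A l"
proof -
  let ?G = "generating_mat A l"
  define y where "y = max_mult_vec ?G z"
  have dims [simp]: "dim_vec y = n" "dim_vec z = length reps"
    using z by (auto simp: y_def nonneg_vecs_def)
  have yi: "y $ i = max_sum (length reps) (\<lambda>t. ?G $$ (i, t) * z $ t)" if "i < n" for i
    using that by (simp add: y_def)
  have z0: "0 \<le> z $ t" if "t < length reps" for t using z that by (simp add: nonneg_vecs_def)
  have G_eigen: "max_sum n (\<lambda>k. A $$ (i, k) * ?G $$ (k, t)) = l * ?G $$ (i, t)"
    if "i < n" "t < length reps" for i t
  proof -
    have "max_sum n (\<lambda>k. A $$ (i, k) * ?G $$ (k, t)) = max_sum n (\<lambda>k. A $$ (i, k) * scaled_closure $$ (k, reps ! t))"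
      by (rule max_sum_cong) (simp add: index_generating_mat that)
    also have "\<dots> = l * ?G $$ (i, t)"
      using closure_col_eigen[OF that(1) reps_less[OF that(2)]] closure_rep_diag[OF that(2)] that
      by (simp add: index_generating_mat)
    finally show ?thesis .
  qed
  have "max_sum n (\<lambda>k. A $$ (i, k) * y $ k) = l * y $ i" if i: "i < n" for i
  proof (rule antisym)
    have y_nonneg: "0 \<le> y $ i" using yi[OF i] max_sum_nonneg by simp
    show "max_sum n (\<lambda>k. A $$ (i, k) * y $ k) \<le> l * y $ i"
      unfolding max_sum_le_iff
    proof (intro conjI allI impI)
      show ly: "0 \<le> l * y $ i" using y_nonneg l by simp
      fix k assume k: "k < n"
      show "A $$ (i, k) * y $ k \<le> l * y $ i"
      \<comment> \<open>A maximising column is guaranteed only for a positive entry, since a zero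
        may be the default of \<open>max_sum\<close>.\<close>
      proof (cases "0 < y $ k")
        case True
        then obtain t where t: "t < length reps" "?G $$ (k, t) * z $ t = y $ k"
          using max_sum_attained[OF yi[OF k, symmetric]] by blast
        have "A $$ (i, k) * ?G $$ (k, t) \<le> l * ?G $$ (i, t)"
          using max_sum_upper[OF k, of "\<lambda>k. A $$ (i, k) * ?G $$ (k, t)"] G_eigen[OF i t(1)] by simp
        then have "A $$ (i, k) * ?G $$ (k, t) * z $ t \<le> l * ?G $$ (i, t) * z $ t"
          using z0[OF t(1)] by (rule mult_right_mono)
        also have "\<dots> \<le> l * y $ i"
          using max_sum_upper[OF t(1), of "\<lambda>t. ?G $$ (i, t) * z $ t"] yi[OF i] l
          by (simp add: mult.assoc)
        finally show ?thesis using t(2) by (simp add: mult.assoc)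
      next
        case False
        then have "A $$ (i, k) * y $ k \<le> 0" using A_nonneg[OF i k] by (simp add: mult_nonneg_nonpos)
        then show ?thesis using ly by simp
      qed
    qed
    show "l * y $ i \<le> max_sum n (\<lambda>k. A $$ (i, k) * y $ k)" (is "_ \<le> ?r")
    proof (cases "0 < y $ i")
      case True
      then obtain t where t: "t < length reps" "?G $$ (i, t) * z $ t = y $ i"
        using max_sum_attained[OF yi[OF i, symmetric]] by blast
      have Git: "0 < ?G $$ (i, t)" "0 < z $ t"
        using True z0[OF t(1)] unfolding t(2)[symmetric] zero_less_mult_iff by auto
      obtain k where k: "k < n" "A $$ (i, k) * ?G $$ (k, t) = l * ?G $$ (i, t)"
        using max_sum_attained[OF G_eigen[OF i t(1)]] Git(1) l by auto
      have "l * y $ i = A $$ (i, k) * (?G $$ (k, t) * z $ t)"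
        using k(2) t(2) by (metis mult.assoc)
      also have "\<dots> \<le> A $$ (i, k) * y $ k"
        using max_sum_upper[OF t(1), of "\<lambda>t. ?G $$ (k, t) * z $ t"] yi[OF k(1)] A_nonneg[OF i k(1)]
        by (intro mult_left_mono) auto
      also have "\<dots> \<le> ?r" by (rule max_sum_upper[OF k(1)])
      finally show ?thesis .
    next
      case False
      then have "l * y $ i \<le> 0" using l by (simp add: mult_nonneg_nonpos)
      also have "0 \<le> ?r" by (rule max_sum_nonneg)
      finally show ?thesis .
    qed
  qed
  then have "max_mult_vec A y = l \<cdot>\<^sub>v y" by (intro eq_vecI) auto
  moreover have "y \<in> nonneg_vecs n"
    using yi max_sum_nonneg by (auto simp: nonneg_vecs_def intro!: carrier_vecI)
  ultimately show ?thesis by (simp add: eigencone_def y_def)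
qed

lemma not_private_rows_span_generating_mat:
  assumes nodes: "critical_nodes A l = {..<n}" and sv: "single_valued crit"
    and "\<not> private_rows"
  obtains s where "s < length reps" "x \<in> max_span (remove_col (generating_mat A l) s)"
proof -
  have rep: "\<exists>t<length reps. (i, reps ! t) \<in> crit\<^sup>*" if "i < n" for i
    using component_rep_exists[of i] that nodes by (metis in_set_conv_nth lessThan_iff)
  have crit_active: "(i, j) \<in> active\<^sup>*" if "(i, j) \<in> crit\<^sup>*" for i j
    using that crit_subset_active rtrancl_mono by blast
  have "\<not> active \<subseteq> crit"
    using active_subset_crit_private_rows[OF nodes sv] assms(3) by blast
  then obtain k j where kj: "(k, j) \<in> active" "(k, j) \<notin> crit" by auto
  obtain s where s: "s < length reps" "(k, reps ! s) \<in> crit\<^sup>*" using rep activeD(1)[OF kj(1)] by blast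
  obtain s' where s': "s' < length reps" "(j, reps ! s') \<in> crit\<^sup>*" using rep activeD(2)[OF kj(1)] by blast
  \<comment> \<open>Within one component the arc \<open>(k, j)\<close> could be closed to an active
    cycle and would be critical.\<close>
  have "s' \<noteq> s"
  proof
    assume "s' = s"
    then have "(j, k) \<in> crit\<^sup>*" using s s' crit_rtrancl_sym rtrancl_trans by metis
    then show False using active_return_crit[OF kj(1) crit_active] kj(2) by blast
  qed
  \<comment> \<open>Nodes outside component \<open>s\<close> use their own representative; those
    inside walk to \<open>k\<close> and escape through \<open>(k, j)\<close> to component
    \<open>s'\<close>.\<close>
  have other: "\<exists>t<length reps. t \<noteq> s \<and> (i, reps ! t) \<in> active\<^sup>+" if i: "i < n" for i
  proof -
    obtain t where t: "t < length reps" "(i, reps ! t) \<in> crit\<^sup>*" using rep[OF i] by blast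
    show ?thesis
    proof (cases "t = s")
      case False
      then show ?thesis using t crit_active critical_trancl_rep by (meson rtrancl_trancl_trancl)
    next
      case True
      then have "(i, k) \<in> active\<^sup>*"
        using t s crit_rtrancl_sym crit_active by (meson rtrancl_trans)
      then have "(i, reps ! s') \<in> active\<^sup>+"
        using kj(1) crit_active[OF s'(2)] by (meson rtrancl_into_trancl1 trancl_rtrancl_trancl)
      then show ?thesis using s'(1) \<open>s' \<noteq> s\<close> by blast
    qed
  qed
  \<comment> \<open>The value \<open>x $ (reps ! t)\<close> is the largest coefficient that keeps
    column \<open>t\<close> below \<open>x\<close>: \<open>closure_le\<close> gives the bound, and
    the diagonal entry 1 makes it sharp. Entry \<open>s\<close> belongs to the removed
    column.\<close>
  define z where "z = vec (length reps) (\<lambda>t. if t = s then 0 else x $ (reps ! t))"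
  have "max_mult_vec (generating_mat A l) z = x"
  proof (rule eq_vecI)
    fix i assume "i < dim_vec x"
    then have i: "i < n" by simp
    obtain t where t: "t < length reps" "t \<noteq> s" "(i, reps ! t) \<in> active\<^sup>+" using other[OF i] by blast
    have "max_sum (length reps) (\<lambda>t. generating_mat A l $$ (i, t) * z $ t) = x $ i"
    proof (rule max_sum_eqI)
      fix t assume "t < length reps"
      then show "generating_mat A l $$ (i, t) * z $ t \<le> x $ i"
        using closure_le[OF i reps_less] pos[OF i] i by (simp add: z_def index_generating_mat)
    next
      show "generating_mat A l $$ (i, t) * z $ t = x $ i"
        using active_trancl_closure[OF t(3)] t i by (simp add: z_def index_generating_mat)
    qed (use t pos[OF i] in auto)
    then show "max_mult_vec (generating_mat A l) z $ i = x $ i" using i by simp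
  qed simp
  moreover have "z \<in> nonneg_vecs (length reps)" "z $ s = 0"
    using s(1) pos reps_less by (auto simp: z_def nonneg_vecs_def less_imp_le)
  ultimately have "x \<in> max_span (remove_col (generating_mat A l) s)"
    using mem_max_span_remove_col_iff[of s "generating_mat A l" x] s(1) by auto
  with s(1) show thesis by (rule that)
qed

text \<open>With private rows active arcs are critical, so the component \<open>S\<close> of the
  removed representative is closed under them. \<open>closure_gap\<close> then keeps every other
  column strictly below \<open>x\<close> at that representative.\<close>

lemma span_generating_mat_not_private_rows:
  assumes s: "s < length reps" and span: "x \<in> max_span (remove_col (generating_mat A l) s)"
  shows "\<not> private_rows"
proof
  assume "private_rows"
  then have eq: "active = crit" by (rule private_rows_active_eq_crit)
  obtain z where z: "z \<in> nonneg_vecs (length reps)" "z $ s = 0" "x = max_mult_vec (generating_mat A l) z"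
    using span mem_max_span_remove_col_iff[of s "generating_mat A l" x] s by auto
  define S where "S = {i. (reps ! s, i) \<in> crit\<^sup>*}"
  have sub: "S \<subseteq> {..<n}"
    using reps_less[OF s] activeD(2) unfolding S_def eq[symmetric] by (auto elim: rtranclE)
  have "j \<in> S" if "(i, j) \<in> active" "i \<in> S" for i j
    using that unfolding S_def eq by (auto intro: rtrancl_into_rtrancl)
  then obtain q where q: "q < 1"
    "\<And>i j. i \<in> S \<Longrightarrow> j < n \<Longrightarrow> j \<notin> S \<Longrightarrow> scaled_closure $$ (i, j) * x $ j \<le> q * x $ i"
    using closure_gap[OF sub] by metis
  let ?i = "reps ! s"
  have row: "x $ i = max_sum (length reps) (\<lambda>t. generating_mat A l $$ (i, t) * z $ t)" if "i < n" for i
    using arg_cong[OF z(3), of "\<lambda>v. v $ i"] that by simp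
  have i: "?i < n" "?i \<in> S" using reps_less[OF s] by (auto simp: S_def)
  obtain t where t: "t < length reps" "generating_mat A l $$ (?i, t) * z $ t = x $ ?i"
    using max_sum_attained[OF row[OF i(1), symmetric] pos[OF i(1)]] by blast
  have ts: "t \<noteq> s" using t(2) z(2) pos[OF i(1)] by auto
  have rt: "reps ! t < n" by (rule reps_less[OF t(1)])
  have "reps ! t \<notin> S"
    using component_reps_separated[of ?i "reps ! t"] ts t(1) s nth_eq_iff_index_eq[of reps t s]
    by (auto simp: S_def component_reps_def)
  \<comment> \<open>Row \<open>reps ! t\<close> bounds the coefficient, since column
    \<open>t\<close> has entry 1 there.\<close>
  have "z $ t \<le> x $ (reps ! t)"
    using max_sum_upper[OF t(1), of "\<lambda>j. generating_mat A l $$ (reps ! t, j) * z $ j"] row[OF rt]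
      closure_rep_diag[OF t(1)] by (simp add: index_generating_mat rt t(1))
  then have "scaled_closure $$ (?i, reps ! t) * z $ t \<le> scaled_closure $$ (?i, reps ! t) * x $ (reps ! t)"
    using closure_nonneg[OF i(1) rt] by (rule mult_left_mono)
  then have "x $ ?i \<le> q * x $ ?i"
    using q(2)[OF i(2) rt \<open>reps ! t \<notin> S\<close>] t i(1) by (simp add: index_generating_mat)
  then show False using q(1) pos[OF i(1)] by simp
qed

end

section \<open>Boxes\<close>

text \<open>Both bounds together give positivity of all vectors in the box, the source of the locale
  assumption \<open>pos\<close>.\<close>

lemma lower_vec_less:
  assumes "\<forall>i<n. nonneg_interval (I i)" "lower_open n I" "y \<in> interval_box n I" "i < n"
  shows "0 \<le> lower_vec n I $ i" "lower_vec n I $ i < y $ i"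
proof -
  have I: "I i \<noteq> {}" "\<And>a. a \<in> I i \<Longrightarrow> 0 \<le> a" and y: "y $ i \<in> I i"
    and notin: "Inf (I i) \<notin> I i"
    using assms by (auto simp: nonneg_interval_def interval_box_def lower_open_def lower_vec_def)
  have "bdd_below (I i)" using I(2) by (rule bdd_belowI)
  then have "Inf (I i) \<le> y $ i" using y by (simp add: cInf_lower)
  moreover have "Inf (I i) \<noteq> y $ i" using y notin by auto
  moreover have "0 \<le> Inf (I i)" using I by (rule cInf_greatest)
  ultimately show "0 \<le> lower_vec n I $ i" "lower_vec n I $ i < y $ i"
    using assms(4) by (auto simp: lower_vec_def)
qed

text \<open>Any span element in the box lies below the upper corner, hence below its projection,
  which then also exceeds the lower corner. Conversely, a projection above the lower corner is
  itself a span element in the box.\<close>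

lemma max_span_meets_box_iff:
  assumes B: "B \<in> nonneg_mats n m"
    and I: "\<forall>i<n. nonneg_interval (I i)"
    and lower: "lower_open n I" and upper: "upper_closed n I"
  shows "max_span B \<inter> interval_box n I \<noteq> {} \<longleftrightarrow>
    vec_greater (max_proj B (upper_vec n I)) (lower_vec n I)"
proof -
  let ?u = "upper_vec n I" and ?l = "lower_vec n I"
  let ?p = "max_proj B ?u"
  have u: "?u \<in> interval_box n I" using upper by (simp add: upper_closed_def)
  have "?u \<in> nonneg_vecs n"
    using u I by (auto simp: nonneg_vecs_def interval_box_def nonneg_interval_def)
  note p = max_proj_greatest[OF B this]
  have dims: "dim_vec ?u = n" "dim_vec ?l = n" "dim_vec ?p = n"
    using p(2) by (auto simp: upper_vec_def lower_vec_def less_eq_vec_def)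
  show ?thesis
  proof
    assume "max_span B \<inter> interval_box n I \<noteq> {}"
    then obtain y where y: "y \<in> max_span B" "y \<in> interval_box n I" by blast
    have "y $ i \<le> ?u $ i" if "i < n" for i
      using y(2) upper that
      by (auto simp: interval_box_def upper_vec_def upper_closed_def intro!: cSup_upper)
    then have "y \<le> ?u" using y(2) dims by (auto simp: less_eq_vec_def interval_box_def)
    then have "y \<le> ?p" by (rule p(3)[OF y(1)])
    then have "?l $ i < ?p $ i" if "i < n" for i
      using lower_vec_less(2)[OF I lower y(2) that] that dims
      by (force simp: less_eq_vec_def)
    then show "vec_greater ?p ?l" using dims by (simp add: vec_greater_def)
  next
    assume g: "vec_greater ?p ?l"
    have "?p $ i \<in> I i" if i: "i < n" for i
    proof -
      have "Inf (I i) < ?p $ i" using g i dims by (simp add: vec_greater_def lower_vec_def)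
      moreover have Ii: "I i \<noteq> {}" "is_interval (I i)" using I i by (auto simp: nonneg_interval_def)
      \<comment> \<open>The infimum is not an element of \<open>I i\<close>, so an actual element
        below \<open>?p $ i\<close> is needed for convexity; the right end is
        \<open>?u $ i\<close>.\<close>
      ultimately obtain a where a: "a \<in> I i" "a < ?p $ i" using cInf_lessD by blast
      have "?p $ i \<le> ?u $ i" using p(2) i dims by (simp add: less_eq_vec_def)
      moreover have "?u $ i \<in> I i" using u i by (simp add: interval_box_def)
      ultimately show ?thesis using a(1) less_imp_le[OF a(2)] Ii(2) mem_is_intervalI[of "I i" a "?u $ i" "?p $ i"] by simp
    qed
    then have "?p \<in> interval_box n I" using dims by (auto simp: interval_box_def intro!: carrier_vecI)
    with p(1) show "max_span B \<inter> interval_box n I \<noteq> {}" by blast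
  qed
qed

lemma (in positive_eigenvector) simple_image_private_rows:
  assumes I: "\<forall>i<n. nonneg_interval (I i)" and lower: "lower_open n I"
    and X: "X = interval_box n I" and xX: "x \<in> X"
    and simple: "simple_image_eigencone A l X"
  shows "private_rows"
proof (rule ccontr)
  assume "\<not> private_rows"
  then obtain i where i: "i < n" "\<And>k. k < n \<Longrightarrow> \<exists>j. j \<noteq> i \<and> (k, j) \<in> active"
    using not_private_rows by blast
  have "Inf (I i) < x $ i"
    using lower_vec_less(2)[OF I lower xX[unfolded X] i(1)] i(1) by (simp add: lower_vec_def)
  moreover have "I i \<noteq> {}" using I i(1) by (simp add: nonneg_interval_def)
  ultimately obtain a where a: "a \<in> I i" "a < x $ i" using cInf_lessD by blast
  define y where "y = vec n (\<lambda>j. if j = i then a else x $ j)"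
  have "max_mult_vec A y = l \<cdot>\<^sub>v x"
    by (rule mult_lowered[OF i]) (use a i(1) in \<open>auto simp: y_def\<close>)
  moreover have "y \<in> X" using xX a(1) by (auto simp: X y_def interval_box_def)
  moreover have "x \<noteq> 0\<^sub>v (dim_col A)" using pos[OF i(1)] i(1) by auto
  ultimately have "y = x" using simple x xX unfolding simple_image_eigencone_def by blast
  moreover have "y $ i = a" using i(1) by (simp add: y_def)
  ultimately show False using a(2) by simp
qed

section \<open>From single eigenvectors to the whole box\<close>

theorem theorem4p17:
  fixes A :: "real mat" and l :: real and n :: nat
    and I :: "nat \<Rightarrow> real set" and X :: "real vec set"
  assumes A: "A \<in> nonneg_mats n n"
    and l: "0 < l"
    and I: "\<forall>i<n. nonneg_interval (I i)"
    and X: "X = interval_box n I"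
    and lower: "lower_open n I"
    and nonempty: "eigencone A l \<inter> X \<noteq> {}"
  shows
    "(simple_image_eigencone A l X \<longleftrightarrow>
        (\<forall>i<n. max_span (remove_col A i) \<inter> eigencone A l \<inter> X = {}))
     \<and> (simple_image_eigencone A l X \<longrightarrow>
        critical_nodes A l = {..<n} \<and>
        (\<exists>cs. consists_of_disjoint_cycles (critical_graph A l) cs))
     \<and> (\<forall>cs. critical_nodes A l = {..<n} \<and>
          consists_of_disjoint_cycles (critical_graph A l) cs \<longrightarrow>
        ((\<forall>i<n. max_span (remove_col A i) \<inter> eigencone A l \<inter> X = {}) \<longleftrightarrow>
         (\<forall>s<length cs. max_span (remove_col (generating_mat A l) s) \<inter> X = {})))
     \<and> (\<forall>cs. critical_nodes A l = {..<n} \<and>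
          consists_of_disjoint_cycles (critical_graph A l) cs \<and> upper_closed n I \<longrightarrow>
        ((\<forall>i<n. max_span (remove_col A i) \<inter> eigencone A l \<inter> X = {}) \<longleftrightarrow>
         (\<forall>s<length cs. \<not> vec_greater
            (max_proj (remove_col (generating_mat A l) s) (upper_vec n I)) (lower_vec n I))))"
proof -
  let ?V = "eigencone A l" and ?G = "generating_mat A l"
  let ?private = "positive_eigenvector.private_rows A l n"
  let ?star = "\<forall>i<n. max_span (remove_col A i) \<inter> ?V \<inter> X = {}"
  let ?simple = "simple_image_eigencone A l X"
  have eig: "positive_eigenvector A l n y" if "y \<in> ?V" "y \<in> X" for y
  proof
    fix i assume "i < n"
    then show "0 < y $ i" using lower_vec_less[OF I lower that(2)[unfolded X]] by force
  qed (use A l that in auto)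
  \<comment> \<open>Turns the span condition into a statement at each eigenvector in the box, the
    form used in all parts.\<close>
  have star: "?star \<longleftrightarrow> (\<forall>y \<in> ?V \<inter> X. ?private y)"
    using positive_eigenvector.private_rows_iff[OF eig] by blast
  obtain x where xV: "x \<in> ?V" and xX: "x \<in> X" using nonempty by blast
  interpret positive_eigenvector A l n x by (rule eig[OF xV xX])

  have part1: "?simple \<longleftrightarrow> ?star"
    unfolding star
  proof
    assume ?simple
    then show "\<forall>y \<in> ?V \<inter> X. ?private y"
      using positive_eigenvector.simple_image_private_rows[OF eig I lower X] by blast
  next
    assume priv: "\<forall>y \<in> ?V \<inter> X. ?private y"
    show ?simple
      unfolding simple_image_eigencone_def
    proof (intro ballI impI equalityI subsetI)
      fix y y' assume y: "y \<in> ?V \<inter> X" and y': "y' \<in> {y' \<in> X. max_mult_vec A y' = l \<cdot>\<^sub>v y}"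
      then have "dim_vec y' = n" by (auto simp: X interval_box_def)
      then show "y' \<in> {y}"
        using positive_eigenvector.private_rows_unique[OF eig, of y y'] y y' priv by auto
    qed (use positive_eigenvector.mult_x[OF eig] in auto)
  qed
  have part2: "?simple \<longrightarrow> critical_nodes A l = {..<n} \<and>
    (\<exists>cs. consists_of_disjoint_cycles (critical_graph A l) cs)"
  proof
    assume ?simple
    then have "private_rows" by (rule simple_image_private_rows[OF I lower X xX])
    then show "critical_nodes A l = {..<n} \<and>
      (\<exists>cs. consists_of_disjoint_cycles (critical_graph A l) cs)"
      by (intro conjI private_rows_critical single_valued_crit_disjoint_cycles)
  qed
  have G: "length reps = length cs" if "consists_of_disjoint_cycles (critical_graph A l) cs" for cs
    using length_component_reps[OF _ that] pair_fin_digraph_critical_graph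
    by (simp add: pair_fin_digraph_def)
  have part3: "?star \<longleftrightarrow> (\<forall>s<length cs. max_span (remove_col ?G s) \<inter> X = {})"
    if nodes: "critical_nodes A l = {..<n}"
      and cs: "consists_of_disjoint_cycles (critical_graph A l) cs" for cs
    unfolding star
  proof
    assume priv: "\<forall>y \<in> ?V \<inter> X. ?private y"
    show "\<forall>s<length cs. max_span (remove_col ?G s) \<inter> X = {}"
    proof (intro allI impI, rule ccontr)
      fix s assume s: "s < length cs" and "max_span (remove_col ?G s) \<inter> X \<noteq> {}"
      then obtain y where y: "y \<in> max_span (remove_col ?G s)" "y \<in> X" by blast
      have s': "s < length reps" using s G[OF cs] by simp
      then have "y \<in> ?V"
        using y(1) span_generating_mat_eigencone mem_max_span_remove_col_iff[of s ?G y] by auto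
      then show False
        using positive_eigenvector.span_generating_mat_not_private_rows[OF eig s' y(1)] y(2) priv
        by blast
    qed
  next
    assume disj: "\<forall>s<length cs. max_span (remove_col ?G s) \<inter> X = {}"
    show "\<forall>y \<in> ?V \<inter> X. ?private y"
    proof (rule ballI, rule ccontr)
      fix y assume y: "y \<in> ?V \<inter> X" and "\<not> ?private y"
      then obtain s where "s < length reps" "y \<in> max_span (remove_col ?G s)"
        using positive_eigenvector.not_private_rows_span_generating_mat[OF eig nodes
            single_valued_disjoint_cycles[OF cs], of y] by blast
      then show False using disj y G[OF cs] by auto
    qed
  qed
  have part4: "?star \<longleftrightarrow>
      (\<forall>s<length cs. \<not> vec_greater (max_proj (remove_col ?G s) (upper_vec n I)) (lower_vec n I))"
    if "critical_nodes A l = {..<n}" and cs: "consists_of_disjoint_cycles (critical_graph A l) cs"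
      and upper: "upper_closed n I" for cs
  proof -
    have "remove_col ?G s \<in> nonneg_mats n (length reps - 1)" if "s < length cs" for s
      using generating_mat_nonneg that G[OF cs] by (auto simp: nonneg_mats_def remove_col_def)
    \<comment> \<open>For each matrix with one column removed, emptiness of the intersection in
      \<open>part3\<close> is the negation of \<open>max_span_meets_box_iff\<close>.\<close>
    then show ?thesis
      using part3[OF that(1,2)] max_span_meets_box_iff[OF _ I lower upper] unfolding X by blast
  qed
  show ?thesis
  proof (intro conjI part1 part2; intro allI impI; elim conjE)
    fix cs assume "critical_nodes A l = {..<n}" "consists_of_disjoint_cycles (critical_graph A l) cs"
    then show "?star \<longleftrightarrow> (\<forall>s<length cs. max_span (remove_col ?G s) \<inter> X = {})" by (rule part3)
  next
    fix cs assume "critical_nodes A l = {..<n}" "consists_of_disjoint_cycles (critical_graph A l) cs"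
      "upper_closed n I"
    then show "?star \<longleftrightarrow> (\<forall>s<length cs. \<not> vec_greater
        (max_proj (remove_col ?G s) (upper_vec n I)) (lower_vec n I))" by (rule part4)
  qed
qed

end
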